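(* Let $p$ be a prime. If a finite $p$-group $G$ contains a normal subgroup $N$ satisfying an outer commutator identity $w(x_1,\dots,x_t)=1$, then $G$ contains a characteristic subgroup $H$ satisfying the same identity and such that $$\operatorname{rank}(G/H)\le f^{t-1}(\operatorname{rank}(G/N)),$$ where $f^k(x)$ is the $k$-th iteration of the function $f(x)=x(x+1)$.
   Context: Outer commutators: let $F(x_1,x_2,\dots)$ be a free group of countable rank. An outer commutator of weight $1$ is a letter $x_i$. An outer commutator of weight $t>1$ is a word of the form $w(x_1,\dots,x_t)=[u(x_1,\dots,x_r),v(x_{r+1},\dots,x_t)]$, where $u$ and $v$ are outer commutators of weights $r$ and $t-r$, respectively (so all letters occurring are different). An outer commutator identity is an identity $w=1$ with $w$ an outer commutator. $\operatorname{rank}G$ is the minimal positive integer $n$ such that any finitely generated subgroup of $G$ is generated by at most $n$ elements. *)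

theory Defs
  imports "HOL-Algebra.Algebra"
begin

text \<open>An element of the free group on \<open>x\<^sub>0, x\<^sub>1, \<dots>\<close> is given by a word in signed letters:
  \<open>(i, True)\<close> stands for \<open>x\<^sub>i\<close> and \<open>(i, False)\<close> for its inverse.\<close>

type_synonym gword = "(nat \<times> bool) list"

definition word_letters :: "gword \<Rightarrow> nat set" where
  "word_letters w = fst ` set w"

definition word_inv :: "gword \<Rightarrow> gword" where
  "word_inv w = rev (map (\<lambda>(i, b). (i, \<not> b)) w)"

definition word_comm :: "gword \<Rightarrow> gword \<Rightarrow> gword" where
  "word_comm u v = word_inv u @ word_inv v @ u @ v"

text \<open>Since \<open>u\<close> and \<open>v\<close> below are nonempty and share no letter, no cancellation occurs when
  the commutator is formed, so every outer commutator is a reduced word. The names of the letters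
  are immaterial; what matters is that different positions carry different letters.\<close>

inductive outer_commutator :: "nat \<Rightarrow> gword \<Rightarrow> bool" where
  letter: "outer_commutator 1 [(i, True)]"
| comm: "outer_commutator r u \<Longrightarrow> outer_commutator s v \<Longrightarrow>
         word_letters u \<inter> word_letters v = {} \<Longrightarrow>
         outer_commutator (r + s) (word_comm u v)"

definition word_value :: "('a, 'b) monoid_scheme \<Rightarrow> (nat \<Rightarrow> 'a) \<Rightarrow> gword \<Rightarrow> 'a" where
  "word_value G \<sigma> w =
     foldr (\<lambda>(i, b) y. (if b then \<sigma> i else inv\<^bsub>G\<^esub> (\<sigma> i)) \<otimes>\<^bsub>G\<^esub> y) w \<one>\<^bsub>G\<^esub>"

definition satisfies_identity :: "('a, 'b) monoid_scheme \<Rightarrow> gword \<Rightarrow> bool" where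
  "satisfies_identity G w \<longleftrightarrow> (\<forall>\<sigma> \<in> UNIV \<rightarrow> carrier G. word_value G \<sigma> w = \<one>\<^bsub>G\<^esub>)"

definition characteristic_subgroup :: "'a set \<Rightarrow> ('a, 'b) monoid_scheme \<Rightarrow> bool" where
  "characteristic_subgroup H G \<longleftrightarrow> subgroup H G \<and> (\<forall>\<phi> \<in> auto G. \<phi> ` H = H)"

text \<open>The rank is at least \<open>1\<close>, also for the trivial group. If no \<open>n\<close> as below exists, the value
  is unspecified; for finite groups such an \<open>n\<close> always exists.\<close>

definition group_rank :: "('a, 'b) monoid_scheme \<Rightarrow> nat" where
  "group_rank G = (LEAST n. n \<ge> 1 \<and>
     (\<forall>S. finite S \<and> S \<subseteq> carrier G \<longrightarrow>
        (\<exists>T. finite T \<and> T \<subseteq> carrier G \<and> card T \<le> n \<and> generate G T = generate G S)))"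

end

theory Submission
  imports Defs
begin

text \<open>The proof has two ingredients: the linearity of outer commutators in each letter, and the fact
  that in a finite \<open>p\<close>-group few automorphic images of a normal subgroup generate all of them.

  \<^emph>\<open>Linearity.\<close> For an outer commutator \<open>w\<close> and normal subgroups \<open>A\<^sub>i\<close>, the condition that \<open>w\<close> vanishes
  when each \<open>x\<^sub>i\<close> ranges over \<open>A\<^sub>i\<close> can be checked on generators in each argument separately: if \<open>w\<close>
  vanishes with \<open>x\<^sub>j\<close> in \<open>B\<close> and with \<open>x\<^sub>j\<close> in \<open>C\<close>, then it vanishes with \<open>x\<^sub>j\<close> in \<open>BC\<close>
  (\<open>outer_commutator_values_generate\<close>).

  \<^emph>\<open>Construction.\<close> Start with \<open>H\<^sub>0 = G\<close> and \<open>M\<^sub>0 = N\<close>. Given a normal subgroup \<open>M\<^sub>k\<close>, let \<open>H\<^sub>k\<^sub>+\<^sub>1\<close> be the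
  characteristic subgroup generated by all images of \<open>M\<^sub>k\<close> under automorphisms, and let \<open>M\<^sub>k\<^sub>+\<^sub>1\<close> be the
  intersection of finitely many of these images that generate \<open>H\<^sub>k\<^sub>+\<^sub>1\<close>. If \<open>w\<close> vanishes with \<open>k\<close> of
  its letters in \<open>H\<^sub>k\<close> and the others in \<open>M\<^sub>k\<close>, then it vanishes with \<open>k + 1\<close> letters in \<open>H\<^sub>k\<^sub>+\<^sub>1\<close> and
  the others in \<open>M\<^sub>k\<^sub>+\<^sub>1\<close>: by linearity the new letter may be restricted to a single image \<open>\<phi>(M\<^sub>k)\<close>,
  which contains \<open>M\<^sub>k\<^sub>+\<^sub>1\<close>, while \<open>H\<^sub>k\<^sub>+\<^sub>1 \<subseteq> H\<^sub>k = \<phi>(H\<^sub>k)\<close>, so \<open>\<phi>\<close> transports the known vanishing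
  (\<open>exchange_letter\<close>). After \<open>t\<close> steps all letters lie in \<open>H\<^sub>t\<close>, which satisfies the identity. Since
  \<open>H\<^sub>t\<close> contains \<open>M\<^sub>t\<^sub>-\<^sub>1\<close>, only \<open>t - 1\<close> of the subgroups \<open>M\<^sub>k\<close> enter the bound on the rank.

  \<^emph>\<open>Counting.\<close> Let \<open>r\<close> be the rank of the quotient by \<open>M = M\<^sub>k\<close>. The group \<open>H\<^sub>k\<^sub>+\<^sub>1/M\<close> is generated by
  \<open>r\<close> elements, and in a finite \<open>p\<close>-group every generating set contains a generating set with no more
  elements than any given one (\<open>p_group_generators_from_set\<close>). So \<open>r\<close> images together with \<open>M\<close>
  generate \<open>H\<^sub>k\<^sub>+\<^sub>1\<close> (\<open>generate_auto_images_by_few\<close>). The quotients by these \<open>r + 1\<close> images have rank \<open>r\<close> as well,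
  and the rank of the quotient by an intersection is at most the sum of the ranks
  (\<open>corank_le_Inter\<close>). Hence each step replaces the bound \<open>r\<close> by \<open>r (r + 1)\<close>.\<close>

section \<open>Normalizers and maximal subgroups of finite p-groups\<close>

text \<open>The orbit sizes are powers of \<open>p\<close>. If \<open>x\<close> were the only fixed point, every other orbit would have
  size divisible by \<open>p\<close>, and \<open>p\<close> would divide \<open>card E - 1\<close> as well as \<open>card E\<close>.\<close>
lemma (in group_action) p_group_second_fixed_point:
  assumes p: "Factorial_Ring.prime p" and ord: "order G = p ^ k"
    and fin: "finite E" and dvd: "p dvd card E"
    and x: "x \<in> E" "\<And>g. g \<in> carrier G \<Longrightarrow> \<phi> g x = x"
  obtains y where "y \<in> E" "y \<noteq> x" "\<And>g. g \<in> carrier G \<Longrightarrow> \<phi> g y = y"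
proof -
  interpret group G using group_hom group_hom.axioms(1) by auto
  have orbx: "orbit G \<phi> x = {x}"
    using x(2) one_closed by (auto simp: orbit_def intro: exI[of _ \<one>])
  have memx: "{x} \<in> orbits G E \<phi>" using x(1) orbx by (auto simp: orbits_def)
  have finO: "finite (orbits G E \<phi>)" using fin by (simp add: orbits_def)
  have "\<exists>y\<in>E. y \<noteq> x \<and> (\<forall>g\<in>carrier G. \<phi> g y = y)"
  proof (rule ccontr)
    assume no: "\<not> ?thesis"
    have "p dvd card B" if B: "B \<in> orbits G E \<phi> - {{x}}" for B
    proof -
      from B obtain y where y: "y \<in> E" "B = orbit G \<phi> y" by (auto simp: orbits_def)
      have "card B dvd p ^ k"
        using orbit_stabilizer_theorem[OF y(1)] ord y(2) by (metis dvd_triv_left)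
      then obtain i where i: "card B = p ^ i" using divides_primepow_nat[OF p] by auto
      have "i \<noteq> 0"
      proof
        assume "i = 0"
        then have "card B = 1" using i by simp
        then have "B = {y}"
          using orbit_refl[OF y(1)] y(2) by (auto simp: card_1_singleton_iff)
        moreover have "\<phi> g y \<in> B" if "g \<in> carrier G" for g
          using that y(2) by (auto simp: orbit_def)
        ultimately show False using no B y(1) by auto
      qed
      then show ?thesis using i by (simp add: dvd_power)
    qed
    then have "p dvd (\<Sum>B\<in>orbits G E \<phi> - {{x}}. card B)" by (rule dvd_sum)
    moreover have "card E = 1 + (\<Sum>B\<in>orbits G E \<phi> - {{x}}. card B)"
      using disjoint_sum[OF fin, of "\<lambda>_. 1::nat"] sum.remove[OF finO memx, of card] by simp
    ultimately have "p dvd 1" using dvd by (metis dvd_add_left_iff)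
    then show False using p by (simp add: prime_nat_iff)
  qed
  then show thesis using that by blast
qed

lemma (in group) p_group_index:
  assumes fin: "finite (carrier G)" and ord: "order G = p ^ k" and p: "Factorial_Ring.prime p"
    and M: "subgroup M G" and ne: "M \<noteq> carrier G"
  shows "\<exists>j. 0 < j \<and> card (rcosets M) = p ^ j"
proof -
  have lag: "card (rcosets M) * card M = p ^ k" using lagrange[OF M] ord by simp
  then obtain j where j: "card (rcosets M) = p ^ j"
    using divides_primepow_nat[OF p] by (metis dvd_triv_left)
  have "j \<noteq> 0"
  proof
    assume "j = 0"
    then have "card M = card (carrier G)" using lag j ord by (simp add: order_def)
    then show False using ne subgroup.subset[OF M] fin by (metis card_subset_eq)
  qed
  then show ?thesis using j by blast
qed

text \<open>\<open>M\<close> acts on its own right cosets, whose number is divisible by \<open>p\<close>, and fixes the coset \<open>M\<close>. A second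
  fixed coset \<open>M #> g\<close> means exactly that \<open>g\<close> conjugates \<open>M\<close> into itself.\<close>
lemma (in group) normalizer_condition:
  assumes fin: "finite (carrier G)" and ord: "order G = p ^ k" and p: "Factorial_Ring.prime p"
    and M: "subgroup M G" and ne: "M \<noteq> carrier G"
  obtains g where "g \<in> carrier G" "g \<notin> M" "\<And>h. h \<in> M \<Longrightarrow> g \<otimes> h \<otimes> inv g \<in> M"
proof -
  define E where "E = rcosets M"
  \<comment> \<open>The inverse turns right multiplication into a left action.\<close>
  define \<phi> where "\<phi> = (\<lambda>h. \<lambda>R\<in>E. R #> inv h)"
  let ?M = "G\<lparr>carrier := M\<rparr>"
  have Msub: "M \<subseteq> carrier G" by (rule subgroup.subset[OF M])
  have ER: "R \<subseteq> carrier G" if "R \<in> E" for R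
    using that rcosets_subset_PowG[OF M] by (auto simp: E_def)
  have closed: "R #> g \<in> E" if "R \<in> E" "g \<in> carrier G" for R g
    using that Msub by (auto simp: E_def RCOSETS_def coset_mult_assoc)
  have shift: "(R #> g) #> g' = R #> (g \<otimes> g')" if "R \<in> E" "g \<in> carrier G" "g' \<in> carrier G" for R g g'
    using coset_mult_assoc[OF ER] that by blast
  have bij: "\<phi> h \<in> Bij E" if h: "h \<in> M" for h
  proof -
    have hc: "h \<in> carrier G" using h Msub by blast
    have "bij_betw (\<phi> h) E E"
      by (rule bij_betw_byWitness[where f' = "\<lambda>R. R #> h"])
        (use hc in \<open>auto simp: \<phi>_def closed shift ER\<close>)
    then show ?thesis by (simp add: Bij_def \<phi>_def)
  qed
  have "\<phi> \<in> hom ?M (BijGroup E)"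
  proof (rule homI)
    fix h h' assume hh: "h \<in> carrier ?M" "h' \<in> carrier ?M"
    then have c: "h \<in> carrier G" "h' \<in> carrier G" using Msub by auto
    have "\<phi> (h \<otimes> h') = compose E (\<phi> h) (\<phi> h')"
      using c by (auto simp: \<phi>_def compose_def closed shift inv_mult_group fun_eq_iff)
    then show "\<phi> (h \<otimes>\<^bsub>?M\<^esub> h') = \<phi> h \<otimes>\<^bsub>BijGroup E\<^esub> \<phi> h'"
      using hh bij by (simp add: BijGroup_def)
  qed (use bij in \<open>simp add: BijGroup_def\<close>)
  then interpret act: group_action ?M E \<phi>
    by (intro group_action.intro group_hom.intro group_hom_axioms.intro
        subgroup_imp_group[OF M] group_BijGroup)
  have "card M dvd p ^ k" using lagrange[OF M] ord by (metis dvd_triv_right)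
  then have "order ?M dvd p ^ k" by (simp add: order_def)
  then obtain i where i: "order ?M = p ^ i" using divides_primepow_nat[OF p] by blast
  obtain j where j: "0 < j" "card E = p ^ j"
    using p_group_index[OF fin ord p M ne] by (auto simp: E_def)
  have ME: "M \<in> E" using subgroup.subgroup_in_rcosets[OF M] is_group by (simp add: E_def)
  have fixM: "\<phi> h M = M" if "h \<in> carrier ?M" for h
    using that ME M Msub by (auto simp: \<phi>_def coset_join2 subgroup.m_inv_closed)
  have finE: "finite E" using fin rcosets_subset_PowG[OF M] by (simp add: E_def finite_subset)
  obtain R where R: "R \<in> E" "R \<noteq> M" "\<And>h. h \<in> M \<Longrightarrow> \<phi> h R = R"
    using act.p_group_second_fixed_point[OF p i finE _ ME fixM] j by auto
  from R(1) obtain g where g: "g \<in> carrier G" "R = M #> g" by (auto simp: E_def RCOSETS_def)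
  have "g \<notin> M" using R(2) g coset_join2[OF _ M] by auto
  moreover have "g \<otimes> h \<otimes> inv g \<in> M" if h: "h \<in> M" for h
  proof -
    have hc: "h \<in> carrier G" using h Msub by blast
    have "R #> h = R" using R(3)[of "inv h"] R(1) h hc subgroup.m_inv_closed[OF M] by (simp add: \<phi>_def)
    then have "M #> (g \<otimes> h) = M #> g" using g hc by (simp add: coset_mult_assoc Msub)
    then have "g \<otimes> h \<in> M #> g" using repr_independenceD[OF M] g hc by (metis m_closed)
    then obtain m where "m \<in> M" "g \<otimes> h = m \<otimes> g" by (auto simp: r_coset_def)
    then show ?thesis using Msub g(1) hc by (metis inv_solve_right m_closed subsetD)
  qed
  ultimately show thesis using that g(1) by blast
qed

text \<open>By the normalizer condition the normalizer of \<open>M\<close> is strictly larger than \<open>M\<close>, so it is the whole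
  group.\<close>
lemma (in group) p_group_maximal_subgroup_normal:
  assumes fin: "finite (carrier G)" and ord: "order G = p ^ k" and p: "Factorial_Ring.prime p"
    and M: "subgroup M G" and ne: "M \<noteq> carrier G"
    and max: "\<And>K. subgroup K G \<Longrightarrow> M \<subset> K \<Longrightarrow> K = carrier G"
  shows "M \<lhd> G"
proof -
  define K where "K = {g \<in> carrier G. (\<lambda>h. g \<otimes> h \<otimes> inv g) ` M = M}"
  have Msub: "M \<subseteq> carrier G" by (rule subgroup.subset[OF M])
  have finM: "finite M" using finite_subset[OF Msub fin] .
  \<comment> \<open>\<open>M\<close> is finite, so conjugation by \<open>g\<close> maps \<open>M\<close> onto \<open>M\<close> as soon as it maps \<open>M\<close> into \<open>M\<close>.\<close>
  have inK: "g \<in> K" if g: "g \<in> carrier G" "\<And>h. h \<in> M \<Longrightarrow> g \<otimes> h \<otimes> inv g \<in> M" for g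
  proof -
    have "inj_on (\<lambda>h. g \<otimes> h \<otimes> inv g) M"
      using g(1) Msub by (auto simp: inj_on_def subset_iff)
    then show ?thesis using g finM endo_inj_surj[of M] by (auto simp: K_def image_subset_iff)
  qed
  have K: "subgroup K G"
  proof (rule subgroupI)
    show "K \<noteq> {}" using inK[OF one_closed] Msub by (auto simp: subset_iff)
  next
    fix g assume gK: "g \<in> K"
    then have g: "g \<in> carrier G" and im: "(\<lambda>h. g \<otimes> h \<otimes> inv g) ` M = M" by (auto simp: K_def)
    show "inv g \<in> K"
    proof (rule inK)
      fix h assume "h \<in> M"
      then obtain m where m: "m \<in> M" "h = g \<otimes> m \<otimes> inv g" using im by blast
      then have "inv g \<otimes> h \<otimes> inv (inv g) = m" using g Msub by (auto simp: m_assoc subset_iff inv_solve_left')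
      then show "inv g \<otimes> h \<otimes> inv (inv g) \<in> M" using m by simp
    qed (use g in simp)
  next
    fix g g' assume gK: "g \<in> K" "g' \<in> K"
    show "g \<otimes> g' \<in> K"
    proof (rule inK)
      fix h assume h: "h \<in> M"
      have "g' \<otimes> h \<otimes> inv g' \<in> M" using gK(2) h unfolding K_def by blast
      then have "g \<otimes> (g' \<otimes> h \<otimes> inv g') \<otimes> inv g \<in> M" using gK(1) unfolding K_def by blast
      then show "g \<otimes> g' \<otimes> h \<otimes> inv (g \<otimes> g') \<in> M"
        using gK h Msub by (auto simp: K_def m_assoc inv_mult_group subset_iff)
    qed (use gK in \<open>auto simp: K_def\<close>)
  qed (auto simp: K_def)
  have "M \<subseteq> K"
    using inK Msub M by (meson subgroup.m_closed subgroup.m_inv_closed subsetD subsetI)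
  moreover obtain g where "g \<in> carrier G" "g \<notin> M" "\<And>h. h \<in> M \<Longrightarrow> g \<otimes> h \<otimes> inv g \<in> M"
    using normalizer_condition[OF fin ord p M ne] by blast
  ultimately have "K = carrier G" using max[OF K] inK by blast
  then show ?thesis using M unfolding normal_inv_iff K_def by blast
qed

section \<open>Homomorphisms to the integers modulo p\<close>

text \<open>Homomorphisms to the cyclic group of order \<open>p\<close>, represented by integer-valued functions that are
  additive only modulo \<open>p\<close>. This makes their linear combinations plain integer sums.\<close>
definition additive_mod :: "('a, 'b) monoid_scheme \<Rightarrow> nat \<Rightarrow> ('a \<Rightarrow> int) \<Rightarrow> bool" where
  "additive_mod G p \<chi> \<longleftrightarrow>
     (\<forall>x\<in>carrier G. \<forall>y\<in>carrier G. int p dvd \<chi> (x \<otimes>\<^bsub>G\<^esub> y) - (\<chi> x + \<chi> y))"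

lemma (in group) prime_order_powers:
  assumes p: "Factorial_Ring.prime p" and ord: "order G = p"
    and a: "a \<in> carrier G" "a \<noteq> \<one>"
  shows "ord a = p" and "\<And>x. x \<in> carrier G \<Longrightarrow> \<exists>i::int. a [^] i = x"
proof -
  have "ord a dvd p" using ord_dvd_group_order[OF a(1)] ord by simp
  then show op: "ord a = p" using p a ord_eq_1[OF a(1)] by (metis prime_nat_iff)
  have fin: "finite (carrier G)" using ord p by (metis card.infinite not_prime_0 order_def)
  have "(\<lambda>i::nat. a [^] i) ` {0..p - 1} = carrier G"
  proof (rule card_subset_eq[OF fin])
    show "card ((\<lambda>i::nat. a [^] i) ` {0..p - 1}) = card (carrier G)"
      using card_image[OF ord_inj[OF a(1)]] op ord prime_gt_0_nat[OF p] by (simp add: order_def)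
  qed (use a in auto)
  then show "\<exists>i::int. a [^] i = x" if "x \<in> carrier G" for x
    using that by (metis imageE int_pow_int)
qed

text \<open>Characters separate \<open>x\<close> from \<open>Q\<close>: a subgroup \<open>M\<close> that is maximal among those containing \<open>Q\<close> but not
  \<open>x\<close> is a maximal subgroup, because \<open>x\<close> and \<open>Q\<close> generate the group. It is therefore normal, the
  quotient has no proper nontrivial subgroup, hence order \<open>p\<close>, and the coset of \<open>x\<close> generates it. The
  character takes the discrete logarithm to the base of this coset.\<close>
lemma (in group) p_group_character:
  assumes fin: "finite (carrier G)" and ord: "order G = p ^ k" and p: "Factorial_Ring.prime p"
    and Q: "subgroup Q G" and x: "x \<in> carrier G" "x \<notin> Q" and gen: "generate G (insert x Q) = carrier G"
  obtains \<chi> where "additive_mod G p \<chi>" "\<And>q. q \<in> Q \<Longrightarrow> int p dvd \<chi> q"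
    "\<not> int p dvd \<chi> x"
proof -
  let ?\<K> = "{K. subgroup K G \<and> Q \<subseteq> K \<and> x \<notin> K}"
  have "finite ?\<K>" by (rule finite_subset[of _ "Pow (carrier G)"]) (use fin in \<open>auto dest: subgroup.subset\<close>)
  then obtain M where M: "subgroup M G" "Q \<subseteq> M" "x \<notin> M"
    and maxM: "\<And>K. subgroup K G \<Longrightarrow> Q \<subseteq> K \<Longrightarrow> x \<notin> K \<Longrightarrow> M \<subseteq> K \<Longrightarrow> M = K"
    using finite_has_maximal2[of ?\<K> Q] Q x by auto
  have max: "K = carrier G" if "subgroup K G" "M \<subset> K" for K
  proof -
    have "x \<in> K" using maxM that M by blast
    then have "generate G (insert x Q) \<subseteq> K" using that M by (intro generate_subgroup_incl) auto
    then show ?thesis using gen subgroup.subset[OF that(1)] by blast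
  qed
  have ne: "M \<noteq> carrier G" using M x by blast
  interpret M: normal M G by (rule p_group_maximal_subgroup_normal[OF fin ord p M(1) ne max])
  let ?Q = "G Mod M"
  interpret Q: group ?Q by (rule M.factorgroup_is_group)
  obtain j where j: "0 < j" "order ?Q = p ^ j"
    using p_group_index[OF fin ord p M(1) ne] by (auto simp: order_def FactGroup_def)
  have finQ: "finite (carrier ?Q)" using j p by (metis card.infinite order_def power_not_zero prime_gt_0_nat less_irrefl)
  interpret \<pi>: group_hom G ?Q "\<lambda>g. M #> g"
    by (intro group_hom.intro group_hom_axioms.intro is_group Q.is_group M.r_coset_hom_Mod)
  \<comment> \<open>The preimage of a subgroup of order \<open>p\<close> properly contains \<open>M\<close>, so it is the whole group.\<close>
  have "order ?Q = p ^ 1 * p ^ (j - 1)" using j by (cases j) auto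
  then obtain S where S: "subgroup S ?Q" "card S = p"
    using sylow_thm[OF p Q.is_group _ finQ] by (metis power_one_right)
  define K where "K = {g \<in> carrier G. M #> g \<in> S}"
  have K: "subgroup K G"
    using M.factgroup_subgroup_union_subgroup[OF S(1)] M.factgroup_subgroup_union_char[OF S(1)]
    by (simp add: K_def)
  have MS: "M \<in> S" using subgroup.one_closed[OF S(1)] by simp
  have MK: "M \<subseteq> K"
    using MS coset_join2[OF _ M(1)] subgroup.mem_carrier[OF M(1)] by (auto simp: K_def)
  have "S \<noteq> {M}" using S(2) prime_gt_1_nat[OF p] by auto
  then obtain R where R: "R \<in> S" "R \<noteq> M" using MS by blast
  then obtain g where g: "g \<in> carrier G" "R = M #> g"
    using subgroup.subset[OF S(1)] by (auto simp: carrier_FactGroup)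
  then have "g \<in> K" "g \<notin> M" using R coset_join2[OF _ M(1)] by (auto simp: K_def)
  then have "K = carrier G" using max[OF K] MK by blast
  then have "order ?Q = p"
    using S subgroup.subset[OF S(1)] by (auto simp: K_def order_def carrier_FactGroup intro!: arg_cong[where f=card])
  define a where "a = M #> x"
  have a: "a \<in> carrier ?Q" "a \<noteq> \<one>\<^bsub>?Q\<^esub>"
    using x M(3) coset_join1[OF _ x(1) M(1)] by (auto simp: a_def carrier_FactGroup)
  have orda: "Q.ord a = p" and powa: "\<And>y. y \<in> carrier ?Q \<Longrightarrow> \<exists>i::int. a [^]\<^bsub>?Q\<^esub> i = y"
    using Q.prime_order_powers[OF p \<open>order ?Q = p\<close> a] by blast+
  define \<chi> where "\<chi> g = (SOME i::int. a [^]\<^bsub>?Q\<^esub> i = M #> g)" for g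
  have \<chi>: "a [^]\<^bsub>?Q\<^esub> \<chi> g = M #> g" if "g \<in> carrier G" for g
    unfolding \<chi>_def using powa[OF \<pi>.hom_closed[OF that]] by (rule someI_ex)
  show thesis
  proof
    show "additive_mod G p \<chi>" unfolding additive_mod_def
    proof (intro ballI)
      fix g h assume gh: "g \<in> carrier G" "h \<in> carrier G"
      have "a [^]\<^bsub>?Q\<^esub> (\<chi> g + \<chi> h) = a [^]\<^bsub>?Q\<^esub> \<chi> (g \<otimes> h)"
        using gh \<chi> \<pi>.hom_mult[OF gh] by (simp add: Q.int_pow_mult[OF a(1)] del: mult_FactGroup)
      then show "int p dvd \<chi> (g \<otimes> h) - (\<chi> g + \<chi> h)"
        using Q.int_pow_eq[OF a(1)] orda by simp
    qed
    have dvd_iff: "int p dvd \<chi> g \<longleftrightarrow> M #> g = M" if "g \<in> carrier G" for g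
      using Q.int_pow_eq_id[OF a(1), of "\<chi> g"] \<chi>[OF that] orda by simp
    show "int p dvd \<chi> q" if "q \<in> Q" for q
    proof -
      have "q \<in> M" using that M by blast
      then show ?thesis using dvd_iff coset_join2[OF _ M(1)] subgroup.mem_carrier[OF M(1)] by blast
    qed
    show "\<not> int p dvd \<chi> x" using dvd_iff[OF x(1)] a(2) by (simp add: a_def)
  qed
qed

lemma (in group) additive_mod_combination:
  assumes "\<And>x. x \<in> B \<Longrightarrow> additive_mod G p (\<chi> x)"
  shows "additive_mod G p (\<lambda>g. \<Sum>x\<in>B. c x * \<chi> x g)"
  unfolding additive_mod_def
proof (intro ballI)
  fix g h assume gh: "g \<in> carrier G" "h \<in> carrier G"
  have "(\<Sum>x\<in>B. c x * \<chi> x (g \<otimes> h)) - ((\<Sum>x\<in>B. c x * \<chi> x g) + (\<Sum>x\<in>B. c x * \<chi> x h))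
      = (\<Sum>x\<in>B. c x * (\<chi> x (g \<otimes> h) - (\<chi> x g + \<chi> x h)))"
    by (simp add: sum.distrib sum_subtractf algebra_simps)
  also have "int p dvd \<dots>"
    using assms gh unfolding additive_mod_def by (intro dvd_sum) (simp add: dvd_mult)
  finally show "int p dvd (\<Sum>x\<in>B. c x * \<chi> x (g \<otimes> h)) - ((\<Sum>x\<in>B. c x * \<chi> x g) + (\<Sum>x\<in>B. c x * \<chi> x h))" .
qed

lemma (in group) additive_mod_kernel:
  assumes \<chi>: "additive_mod G p \<chi>"
  shows "subgroup {g \<in> carrier G. int p dvd \<chi> g} G"
proof -
  have add: "int p dvd \<chi> (x \<otimes> y) \<longleftrightarrow> int p dvd \<chi> x + \<chi> y" if "x \<in> carrier G" "y \<in> carrier G" for x y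
  proof -
    have "int p dvd \<chi> (x \<otimes> y) - (\<chi> x + \<chi> y)" using \<chi> that by (simp add: additive_mod_def)
    from dvd_add_right_iff[OF this, of "\<chi> x + \<chi> y"] show ?thesis by simp
  qed
  have one: "int p dvd \<chi> \<one>"
  proof -
    have "int p dvd \<chi> (\<one> \<otimes> \<one>) - (\<chi> \<one> + \<chi> \<one>)"
      using \<chi> one_closed unfolding additive_mod_def by blast
    then show ?thesis by simp
  qed
  show ?thesis
  proof (rule subgroupI)
    show "{g \<in> carrier G. int p dvd \<chi> g} \<noteq> {}" using one by blast
  next
    fix g assume "g \<in> {g \<in> carrier G. int p dvd \<chi> g}"
    then have g: "g \<in> carrier G" "int p dvd \<chi> g" by auto
    have "int p dvd \<chi> (inv g) + \<chi> g" using add[of "inv g" g] one g by simp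
    then show "inv g \<in> {g \<in> carrier G. int p dvd \<chi> g}" using g by (simp add: dvd_add_left_iff)
  qed (auto simp: add)
qed

section \<open>Generating sets of finite p-groups\<close>

text \<open>For each \<open>x\<close> in the irredundant set \<open>B\<close> there is a character that vanishes on \<open>N\<close> and on the rest of
  \<open>B\<close> but not at \<open>x\<close>. The combinations of these characters with coefficients in \<open>{0..<p}\<close> are
  \<open>p ^ card B\<close> different characters modulo \<open>p\<close>. All of them vanish on \<open>N\<close>, so each is determined by its
  residues on \<open>T\<close>, which leaves at most \<open>p ^ card T\<close> possibilities.\<close>
lemma (in group) p_group_irredundant_card_le:
  assumes fin: "finite (carrier G)" and ord: "order G = p ^ k" and p: "Factorial_Ring.prime p"
    and N: "N \<subseteq> carrier G" and T: "T \<subseteq> carrier G" "generate G (T \<union> N) = carrier G"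
    and B: "B \<subseteq> carrier G" "generate G (B \<union> N) = carrier G"
    and irr: "\<And>x. x \<in> B \<Longrightarrow> x \<notin> generate G (B - {x} \<union> N)"
  shows "card B \<le> card T"
proof -
  have finX: "finite B" and finT: "finite T" using finite_subset fin B T by blast+
  have "\<exists>\<chi>. additive_mod G p \<chi> \<and> (\<forall>q\<in>B - {x} \<union> N. int p dvd \<chi> q) \<and> \<not> int p dvd \<chi> x"
    if x: "x \<in> B" for x
  proof -
    let ?Q = "generate G (B - {x} \<union> N)"
    have sub: "B - {x} \<union> N \<subseteq> carrier G" using B N by blast
    have "B \<union> N \<subseteq> insert x ?Q" using generate.incl[of _ "B - {x} \<union> N" G] by blast
    then have "generate G (insert x ?Q) = carrier G"
      using mono_generate[of "B \<union> N" "insert x ?Q"] B x generate_incl[OF sub]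
        generate_incl[of "insert x ?Q"] by blast
    then obtain \<chi> where "additive_mod G p \<chi>" "\<And>q. q \<in> ?Q \<Longrightarrow> int p dvd \<chi> q" "\<not> int p dvd \<chi> x"
      using p_group_character[OF fin ord p generate_is_subgroup[OF sub] _ irr[OF x]] x B by blast
    then show ?thesis using generate.incl[of _ "B - {x} \<union> N" G] by blast
  qed
  then obtain \<chi> where add: "\<And>x. x \<in> B \<Longrightarrow> additive_mod G p (\<chi> x)"
    and van: "\<And>x q. x \<in> B \<Longrightarrow> q \<in> B - {x} \<union> N \<Longrightarrow> int p dvd \<chi> x q"
    and nz: "\<And>x. x \<in> B \<Longrightarrow> \<not> int p dvd \<chi> x x"
    by metis
  define h where "h c g = (\<Sum>x\<in>B. c x * \<chi> x g)" for c :: "'a \<Rightarrow> int" and g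
  have h_add: "additive_mod G p (h c)" for c
    unfolding h_def using additive_mod_combination[OF add] .
  let ?C = "B \<rightarrow>\<^sub>E {0..<int p}" and ?D = "T \<rightarrow>\<^sub>E {0..<int p}"
  let ?F = "\<lambda>c. restrict (\<lambda>t. h c t mod int p) T"
  have p0: "0 < int p" using prime_gt_0_nat[OF p] by simp
  have "inj_on ?F ?C"
  proof (rule inj_onI)
    fix c d assume c: "c \<in> ?C" and d: "d \<in> ?C" and eq: "?F c = ?F d"
    \<comment> \<open>The characters of \<open>c\<close> and \<open>d\<close> agree on a subgroup containing \<open>T\<close> and \<open>N\<close>, hence everywhere.\<close>
    let ?K = "{g \<in> carrier G. int p dvd h c g - h d g}"
    have "h (\<lambda>x. c x - d x) g = h c g - h d g" for g
      by (simp add: h_def left_diff_distrib sum_subtractf)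
    then have K: "subgroup ?K G"
      using additive_mod_kernel[OF h_add[of "\<lambda>x. c x - d x"]] by simp
    have "T \<union> N \<subseteq> ?K"
    proof
      fix g assume g: "g \<in> T \<union> N"
      have "int p dvd h c g - h d g"
      proof (cases "g \<in> T")
        case True
        then have "h c g mod int p = h d g mod int p" using fun_cong[OF eq, of g] by simp
        then show ?thesis by (simp add: mod_eq_dvd_iff)
      next
        case False
        then have "int p dvd h c g" "int p dvd h d g"
          using g van unfolding h_def by (auto intro!: dvd_sum dvd_mult)
        then show ?thesis by (rule dvd_diff)
      qed
      then show "g \<in> ?K" using g T N by blast
    qed
    then have all: "carrier G \<subseteq> ?K" using generate_subgroup_incl[OF _ K] T by blast
    show "c = d"
    proof (rule PiE_ext[OF c d])
      fix x assume x: "x \<in> B"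
      \<comment> \<open>At \<open>x\<close> only the summand of \<open>x\<close> survives, so the value there recovers the coefficient.\<close>
      have split: "\<exists>m. h c x = c x * \<chi> x x + int p * m" for c
      proof -
        have "int p dvd (\<Sum>y\<in>B - {x}. c y * \<chi> y x)"
          using van x by (intro dvd_sum dvd_mult) auto
        then show ?thesis unfolding h_def sum.remove[OF finX x] by (auto simp: dvd_def)
      qed
      obtain m m' where "h c x = c x * \<chi> x x + int p * m" "h d x = d x * \<chi> x x + int p * m'"
        using split by blast
      moreover have "int p dvd h c x - h d x" using all x B by blast
      ultimately have "int p dvd (c x * \<chi> x x + int p * m) - (d x * \<chi> x x + int p * m')" by simp
      then have "int p dvd (c x - d x) * \<chi> x x + int p * (m - m')" by (simp add: algebra_simps)
      then have "int p dvd (c x - d x) * \<chi> x x" by (simp add: dvd_add_left_iff)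
      then have "int p dvd c x - d x" using nz[OF x] p by (simp add: prime_dvd_mult_iff)
      then have "c x mod int p = d x mod int p" by (simp add: mod_eq_dvd_iff)
      then show "c x = d x" using PiE_mem[OF c x] PiE_mem[OF d x] by simp
    qed
  qed
  moreover have "?F ` ?C \<subseteq> ?D" using p0 by auto
  moreover have "finite ?D" using finT by (simp add: finite_PiE)
  ultimately have "card ?C \<le> card ?D" by (rule card_inj_on_le)
  then have "p ^ card B \<le> p ^ card T" using finX finT by (simp add: card_PiE)
  then show ?thesis using prime_gt_1_nat[OF p] by simp
qed

text \<open>The Burnside basis property relative to \<open>N\<close>: every set \<open>Y\<close> generating the group together with \<open>N\<close>
  contains a generating set no larger than any given one, namely any minimal generating subset. For
  groups that are not \<open>p\<close>-groups this fails, as the generating set \<open>{2, 3}\<close> of the cyclic group of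
  order 6 shows.\<close>
lemma (in group) p_group_generators_from_set:
  assumes fin: "finite (carrier G)" and ord: "order G = p ^ k" and p: "Factorial_Ring.prime p"
    and N: "N \<subseteq> carrier G" and T: "T \<subseteq> carrier G" "generate G (T \<union> N) = carrier G"
    and Y: "Y \<subseteq> carrier G" "generate G (Y \<union> N) = carrier G"
  obtains B where "B \<subseteq> Y" "card B \<le> card T" "generate G (B \<union> N) = carrier G"
proof -
  let ?\<X> = "{B. B \<subseteq> Y \<and> generate G (B \<union> N) = carrier G}"
  have "finite ?\<X>" using finite_subset[OF Y(1) fin] by simp
  then obtain B where B: "B \<subseteq> Y" "generate G (B \<union> N) = carrier G"
    and min: "\<And>Z. Z \<subseteq> Y \<Longrightarrow> generate G (Z \<union> N) = carrier G \<Longrightarrow> Z \<subseteq> B \<Longrightarrow> B = Z"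
    using finite_has_minimal2[of ?\<X> Y] Y by auto
  have "x \<notin> generate G (B - {x} \<union> N)" if x: "x \<in> B" for x
  proof
    assume x': "x \<in> generate G (B - {x} \<union> N)"
    have sub: "B - {x} \<union> N \<subseteq> carrier G" using B Y N by blast
    have "B \<union> N \<subseteq> generate G (B - {x} \<union> N)"
      using x' generate.incl[of _ "B - {x} \<union> N" G] by blast
    then have "generate G (B - {x} \<union> N) = carrier G"
      using generate_subgroup_incl[OF _ generate_is_subgroup[OF sub]] B(2) generate_incl[OF sub] by blast
    then have "B = B - {x}" using min B(1) by blast
    then show False using x by blast
  qed
  then have "card B \<le> card T"
    using p_group_irredundant_card_le[OF fin ord p N T _ B(2)] B Y by blast
  then show thesis using that B by blast
qed

section \<open>Corank of a subgroup\<close>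

text \<open>For a normal subgroup \<open>N\<close> of a finite group and positive \<open>n\<close> this says that the rank of the quotient
  by \<open>N\<close> is at most \<open>n\<close>. The condition avoids the quotient: every subgroup \<open>K\<close> is generated by \<open>n\<close> of its elements together with the part of
  it that lies in \<open>N\<close>. In this form monotonicity in \<open>N\<close> and subadditivity under intersections are
  immediate.\<close>
definition corank_le :: "('a, 'b) monoid_scheme \<Rightarrow> 'a set \<Rightarrow> nat \<Rightarrow> bool" where
  "corank_le G N n \<longleftrightarrow> (\<forall>K. subgroup K G \<longrightarrow>
     (\<exists>T. finite T \<and> T \<subseteq> K \<and> card T \<le> n \<and> generate G (T \<union> (K \<inter> N)) = K))"

lemma corank_leE:
  assumes "corank_le G N n" "subgroup K G"
  obtains T where "finite T" "T \<subseteq> K" "card T \<le> n" "generate G (T \<union> (K \<inter> N)) = K"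
  using assms(1)[unfolded corank_le_def, rule_format, OF assms(2)] by blast

lemma (in group) corank_le_mono:
  assumes "corank_le G N n" "N \<subseteq> N'"
  shows "corank_le G N' n"
  unfolding corank_le_def
proof (intro allI impI)
  fix K assume K: "subgroup K G"
  obtain T where T: "finite T" "T \<subseteq> K" "card T \<le> n" "generate G (T \<union> (K \<inter> N)) = K"
    using corank_leE[OF assms(1) K] .
  have "K \<subseteq> generate G (T \<union> (K \<inter> N'))"
    using mono_generate[of "T \<union> (K \<inter> N)" "T \<union> (K \<inter> N')"] T(4) assms(2) by blast
  moreover have "generate G (T \<union> (K \<inter> N')) \<subseteq> K"
    by (rule generate_subgroup_incl[OF _ K]) (use T(2) in blast)
  ultimately show "\<exists>T. finite T \<and> T \<subseteq> K \<and> card T \<le> n \<and> generate G (T \<union> (K \<inter> N')) = K"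
    using T by blast
qed

text \<open>Generate \<open>K\<close> by \<open>m\<close> elements and \<open>K \<inter> A\<close>, and then generate \<open>K \<inter> A\<close> by \<open>n\<close> elements and
  \<open>K \<inter> A \<inter> B\<close>.\<close>
lemma (in group) corank_le_Int:
  assumes A: "subgroup A G" "corank_le G A m" and B: "corank_le G B n"
  shows "corank_le G (A \<inter> B) (m + n)"
  unfolding corank_le_def
proof (intro allI impI)
  fix K assume K: "subgroup K G"
  obtain S where S: "finite S" "S \<subseteq> K" "card S \<le> m" "generate G (S \<union> (K \<inter> A)) = K"
    using corank_leE[OF A(2) K] .
  have KA: "subgroup (K \<inter> A) G" using subgroups_Inter_pair[OF K A(1)] .
  obtain T where T: "finite T" "T \<subseteq> K \<inter> A" "card T \<le> n"
      "generate G (T \<union> (K \<inter> A \<inter> B)) = K \<inter> A"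
    using corank_leE[OF B KA] .
  let ?U = "S \<union> T \<union> (K \<inter> (A \<inter> B))"
  have U: "?U \<subseteq> K" using S(2) T(2) by blast
  have gU: "subgroup (generate G ?U) G"
    using U subgroup.subset[OF K] by (intro generate_is_subgroup) blast
  have "K \<inter> A \<subseteq> generate G ?U"
    using mono_generate[of "T \<union> (K \<inter> A \<inter> B)" ?U] T(4) by blast
  then have "S \<union> (K \<inter> A) \<subseteq> generate G ?U" using generate.incl[of _ ?U G] by blast
  from generate_subgroup_incl[OF this gU] have "K \<subseteq> generate G ?U" by (simp only: S(4))
  then have "generate G ?U = K" using generate_subgroup_incl[OF U K] by blast
  moreover have "card (S \<union> T) \<le> m + n" using card_Un_le[of S T] S(3) T(3) by linarith
  ultimately show "\<exists>T. finite T \<and> T \<subseteq> K \<and> card T \<le> m + n \<and> generate G (T \<union> (K \<inter> (A \<inter> B))) = K"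
    using S T by (intro exI[of _ "S \<union> T"]) auto
qed

lemma (in group) corank_le_Inter:
  assumes "finite \<E>" "\<E> \<noteq> {}" and "\<And>E. E \<in> \<E> \<Longrightarrow> subgroup E G" "\<And>E. E \<in> \<E> \<Longrightarrow> corank_le G E r"
  shows "corank_le G (\<Inter>\<E>) (card \<E> * r)"
  using assms
proof (induction \<E> rule: finite_ne_induct)
  case (insert E \<E>)
  then have "corank_le G (E \<inter> \<Inter>\<E>) (r + card \<E> * r)" by (intro corank_le_Int) auto
  then show ?case using insert by simp
qed simp

lemma (in group) auto_group_hom: "\<phi> \<in> auto G \<Longrightarrow> group_hom G G \<phi>"
  by (simp add: auto_def group_hom_def group_hom_axioms_def)

lemma auto_image_carrier: "\<phi> \<in> auto G \<Longrightarrow> \<phi> ` carrier G = carrier G"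
  by (simp add: auto_def Bij_def bij_betw_def)

lemma (in group) corank_le_auto_image:
  assumes \<phi>: "\<phi> \<in> auto G" and N: "N \<subseteq> carrier G" and cr: "corank_le G N n"
  shows "corank_le G (\<phi> ` N) n"
  unfolding corank_le_def
proof (intro allI impI)
  interpret \<phi>: group_hom G G \<phi> by (rule auto_group_hom[OF \<phi>])
  fix K assume K: "subgroup K G"
  define L where "L = {g \<in> carrier G. \<phi> g \<in> K}"
  have L: "subgroup L G"
    unfolding L_def using K subgroup.one_closed[OF K]
    by (intro subgroupI) (auto simp: subgroup.m_closed subgroup.m_inv_closed)
  have KL: "\<phi> ` L = K"
    using auto_image_carrier[OF \<phi>] subgroup.subset[OF K] by (auto simp: L_def)
  have KN: "K \<inter> \<phi> ` N = \<phi> ` (L \<inter> N)" using N by (auto simp: L_def)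
  obtain T where T: "finite T" "T \<subseteq> L" "card T \<le> n" "generate G (T \<union> (L \<inter> N)) = L"
    using corank_leE[OF cr L] .
  have "T \<union> (L \<inter> N) \<subseteq> carrier G" using T(2) subgroup.subset[OF L] by blast
  from \<phi>.generate_img[OF this] have "generate G (\<phi> ` T \<union> (K \<inter> \<phi> ` N)) = K"
    by (simp add: image_Un KN T(4) KL)
  then show "\<exists>T. finite T \<and> T \<subseteq> K \<and> card T \<le> n \<and> generate G (T \<union> (K \<inter> \<phi> ` N)) = K"
    using T KL card_image_le[OF T(1), of \<phi>] by (intro exI[of _ "\<phi> ` T"]) auto
qed

text \<open>The minimum defining the rank is attained, since a finite set \<open>S\<close> can serve as its own \<open>T\<close> and has at
  most as many elements as the carrier. The witness \<open>card (carrier G) + 1\<close> is positive even if the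
  carrier is empty.\<close>
lemma group_rank_spec:
  assumes "finite (carrier G)"
  shows "1 \<le> group_rank G"
    and "\<And>S. S \<subseteq> carrier G \<Longrightarrow>
      \<exists>T. finite T \<and> T \<subseteq> carrier G \<and> card T \<le> group_rank G \<and> generate G T = generate G S"
proof -
  let ?P = "\<lambda>n. n \<ge> 1 \<and> (\<forall>S. finite S \<and> S \<subseteq> carrier G \<longrightarrow>
        (\<exists>T. finite T \<and> T \<subseteq> carrier G \<and> card T \<le> n \<and> generate G T = generate G S))"
  have "?P (card (carrier G) + 1)"
    using card_mono[OF assms] by (auto intro: le_SucI)
  then have "?P (group_rank G)" unfolding group_rank_def by (rule LeastI)
  then show "1 \<le> group_rank G" by (rule conjunct1)
  fix S assume "S \<subseteq> carrier G"
  then have "finite S \<and> S \<subseteq> carrier G" using finite_subset[OF _ assms] by blast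
  then show "\<exists>T. finite T \<and> T \<subseteq> carrier G \<and> card T \<le> group_rank G \<and> generate G T = generate G S"
    using \<open>?P (group_rank G)\<close> by simp
qed

lemma (in normal) projection_group_hom: "group_hom G (G Mod H) (\<lambda>g. H #> g)"
  by (intro group_hom.intro group_hom_axioms.intro is_group factorgroup_is_group r_coset_hom_Mod)

text \<open>Generators of the image of \<open>K\<close> in the quotient lift to elements \<open>T\<close> of \<open>K\<close>. Every element of \<open>K\<close> then
  differs from an element of the subgroup generated by \<open>T\<close> by an element of \<open>K \<inter> H\<close>.\<close>
lemma (in normal) corank_le_group_rank_quotient:
  assumes fin: "finite (carrier G)"
  shows "corank_le G H (group_rank (G Mod H))"
  unfolding corank_le_def
proof (intro allI impI)
  let ?Q = "G Mod H" and ?\<pi> = "\<lambda>g. H #> g"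
  interpret \<pi>: group_hom G ?Q ?\<pi> by (rule projection_group_hom)
  fix K assume K: "subgroup K G"
  have Ksub: "K \<subseteq> carrier G" by (rule subgroup.subset[OF K])
  have finQ: "finite (carrier ?Q)" using fin by (simp add: carrier_FactGroup)
  have genK: "generate G K = K" using generateI[OF K] by blast
  then have genQ: "generate ?Q (?\<pi> ` K) = ?\<pi> ` K" using \<pi>.generate_img[OF Ksub] by simp
  have "?\<pi> ` K \<subseteq> carrier ?Q" using Ksub by (auto simp: carrier_FactGroup)
  from group_rank_spec(2)[OF finQ this] obtain S where S: "finite S" "card S \<le> group_rank ?Q"
    and genS: "generate ?Q S = ?\<pi> ` K" unfolding genQ by blast
  have "S \<subseteq> ?\<pi> ` K" using genS generate.incl[of _ S ?Q] by blast
  from this[unfolded subset_image_inj]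
  obtain T where T: "T \<subseteq> K" "inj_on ?\<pi> T" "?\<pi> ` T = S" by (elim exE conjE) simp
  have finT: "finite T" and cardT: "card T = card S"
    using T S finite_image_iff[of ?\<pi> T] card_image[of ?\<pi> T] by auto
  have Tsub: "T \<subseteq> carrier G" using T Ksub by blast
  let ?U = "T \<union> (K \<inter> H)"
  have Usub: "?U \<subseteq> carrier G" using Tsub Ksub by blast
  have "K \<subseteq> generate G ?U"
  proof
    fix k assume k: "k \<in> K"
    have "?\<pi> ` K = ?\<pi> ` generate G T" using genS \<pi>.generate_img[OF Tsub] T(3) by simp
    then have "?\<pi> k \<in> ?\<pi> ` generate G T" using k by blast
    then obtain s where s: "s \<in> generate G T" "?\<pi> k = ?\<pi> s" by blast
    have kc: "k \<in> carrier G" using k Ksub by blast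
    have "k \<in> H #> s" using rcos_self[OF kc subgroup_axioms] s(2) by simp
    then obtain h where h: "h \<in> H" "k = h \<otimes> s" by (auto simp: r_coset_def)
    have sK: "s \<in> K" using s(1) generate_subgroup_incl[OF T(1) K] by blast
    have "h = k \<otimes> inv s" using h kc sK Ksub by (auto simp: subset_iff inv_solve_right)
    then have "h \<in> K" using k sK K by (simp add: subgroup.m_closed subgroup.m_inv_closed)
    then have "h \<in> generate G ?U" using h by (intro generate.incl) blast
    moreover have "s \<in> generate G ?U" using s(1) mono_generate[of T ?U] by blast
    ultimately show "k \<in> generate G ?U" unfolding h(2) by (rule generate.eng)
  qed
  moreover have "generate G ?U \<subseteq> K"
    by (rule generate_subgroup_incl[OF _ K]) (use T(1) in blast)
  ultimately show "\<exists>T. finite T \<and> T \<subseteq> K \<and> card T \<le> group_rank ?Q \<and> generate G (T \<union> (K \<inter> H)) = K"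
    using finT T(1) cardT S(2) by (intro exI[of _ T]) auto
qed

text \<open>Every subgroup of the quotient is the image of its preimage \<open>K\<close>, and the part \<open>K \<inter> H\<close> of \<open>K\<close> vanishes in
  the quotient. The rank is positive by definition, whence the condition \<open>1 \<le> n\<close>.\<close>
lemma (in normal) group_rank_quotient_le:
  assumes cr: "corank_le G H n" and n: "1 \<le> n"
  shows "group_rank (G Mod H) \<le> n"
  unfolding group_rank_def
proof (rule Least_le, intro conjI allI impI)
  show "1 \<le> n" by (rule n)
  let ?Q = "G Mod H" and ?\<pi> = "\<lambda>g. H #> g"
  interpret \<pi>: group_hom G ?Q ?\<pi> by (rule projection_group_hom)
  fix S assume S: "finite S \<and> S \<subseteq> carrier ?Q"
  have gS: "subgroup (generate ?Q S) ?Q" using S by (intro \<pi>.H.generate_is_subgroup) blast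
  define K where "K = {g \<in> carrier G. ?\<pi> g \<in> generate ?Q S}"
  have K: "subgroup K G"
    using factgroup_subgroup_union_subgroup[OF gS] factgroup_subgroup_union_char[OF gS]
    by (simp add: K_def)
  have KS: "?\<pi> ` K = generate ?Q S"
    using subgroup.subset[OF gS] by (auto simp: K_def carrier_FactGroup)
  obtain T where T: "finite T" "T \<subseteq> K" "card T \<le> n" "generate G (T \<union> (K \<inter> H)) = K"
    using corank_leE[OF cr K] .
  have Tc: "?\<pi> ` T \<subseteq> carrier ?Q"
    using T(2) subgroup.subset[OF K] by (auto simp: carrier_FactGroup)
  have gT: "subgroup (generate ?Q (?\<pi> ` T)) ?Q" by (rule \<pi>.H.generate_is_subgroup[OF Tc])
  have "?\<pi> ` (K \<inter> H) \<subseteq> generate ?Q (?\<pi> ` T)"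
    using coset_join2[OF mem_carrier subgroup_axioms] subgroup.one_closed[OF gT] by auto
  then have "?\<pi> ` (T \<union> (K \<inter> H)) \<subseteq> generate ?Q (?\<pi> ` T)"
    using generate.incl[of _ "?\<pi> ` T" ?Q] by blast
  then have "generate ?Q (?\<pi> ` (T \<union> (K \<inter> H))) \<subseteq> generate ?Q (?\<pi> ` T)"
    by (rule \<pi>.H.generate_subgroup_incl[OF _ gT])
  moreover have "T \<union> (K \<inter> H) \<subseteq> carrier G" using T(2) subgroup.subset[OF K] by blast
  ultimately have "?\<pi> ` generate G (T \<union> (K \<inter> H)) \<subseteq> generate ?Q (?\<pi> ` T)"
    by (simp only: \<pi>.generate_img)
  then have "generate ?Q S \<subseteq> generate ?Q (?\<pi> ` T)" using T(4) KS by simp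
  moreover have "generate ?Q (?\<pi> ` T) \<subseteq> generate ?Q S"
    by (rule \<pi>.H.generate_subgroup_incl[OF _ gS]) (use T(2) KS in blast)
  ultimately have "generate ?Q (?\<pi> ` T) = generate ?Q S" by blast
  moreover have "card (?\<pi> ` T) \<le> n" using card_image_le[OF T(1)] T(3) le_trans by blast
  ultimately show "\<exists>T. finite T \<and> T \<subseteq> carrier ?Q \<and> card T \<le> n \<and> generate ?Q T = generate ?Q S"
    using T(1) Tc by blast
qed

section \<open>Images of a subgroup under automorphisms\<close>

lemma (in group) auto_image_normal:
  assumes \<phi>: "\<phi> \<in> auto G" and N: "N \<lhd> G"
  shows "\<phi> ` N \<lhd> G"
proof -
  interpret \<phi>: group_hom G G \<phi> by (rule auto_group_hom[OF \<phi>])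
  have sub: "subgroup N G" by (rule normal_imp_subgroup[OF N])
  have "x \<otimes> h \<otimes> inv x \<in> \<phi> ` N" if xh: "x \<in> carrier G" "h \<in> \<phi> ` N" for x h
  proof -
    obtain y where y: "y \<in> carrier G" "x = \<phi> y" using xh(1) auto_image_carrier[OF \<phi>] by blast
    obtain n where n: "n \<in> N" "h = \<phi> n" using xh(2) by blast
    have nc: "n \<in> carrier G" using n subgroup.mem_carrier[OF sub] by blast
    have "y \<otimes> n \<otimes> inv y \<in> N" using N y n by (simp add: normal_inv_iff)
    moreover have "x \<otimes> h \<otimes> inv x = \<phi> (y \<otimes> n \<otimes> inv y)" using y n nc by simp
    ultimately show ?thesis by blast
  qed
  then show ?thesis using \<phi>.subgroup_img_is_subgroup[OF sub] by (simp add: normal_inv_iff)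
qed

lemma (in group) inner_automorphism:
  assumes "g \<in> carrier G"
  shows "(\<lambda>x\<in>carrier G. g \<otimes> x \<otimes> inv g) \<in> auto G"
proof -
  interpret group_action G "carrier G" "\<lambda>g. \<lambda>h\<in>carrier G. g \<otimes> h \<otimes> inv g"
    by (rule action_by_conjugation)
  have "g \<otimes> (x \<otimes> y) \<otimes> inv g = g \<otimes> x \<otimes> inv g \<otimes> (g \<otimes> y \<otimes> inv g)"
    if "x \<in> carrier G" "y \<in> carrier G" for x y
    using assms that by (simp add: m_assoc) (simp add: m_assoc[symmetric])
  then show ?thesis using bij_prop0[OF assms] assms by (auto simp: auto_def hom_def)
qed

lemma (in group) characteristic_imp_normal:
  assumes "characteristic_subgroup H G"
  shows "H \<lhd> G"
proof -
  have H: "subgroup H G" and im: "\<And>\<phi>. \<phi> \<in> auto G \<Longrightarrow> \<phi> ` H = H"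
    using assms by (auto simp: characteristic_subgroup_def)
  have "g \<otimes> h \<otimes> inv g \<in> H" if "g \<in> carrier G" "h \<in> H" for g h
    using im[OF inner_automorphism[OF that(1)]] that subgroup.mem_carrier[OF H that(2)] by force
  then show ?thesis using H by (simp add: normal_inv_iff)
qed

definition auto_images :: "('a, 'b) monoid_scheme \<Rightarrow> 'a set \<Rightarrow> 'a set set" where
  "auto_images G M = (\<lambda>\<phi>. \<phi> ` M) ` auto G"

lemma (in group) self_in_auto_images:
  assumes "M \<subseteq> carrier G"
  shows "M \<in> auto_images G M"
  unfolding auto_images_def
proof (rule image_eqI[OF _ id_in_auto])
  have "(\<lambda>x\<in>carrier G. x) ` M = (\<lambda>x. x) ` M" by (rule image_cong) (use assms in auto)
  then show "M = (\<lambda>x\<in>carrier G. x) ` M" by simp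
qed

text \<open>Every automorphism permutes the images of \<open>M\<close>; the reverse inclusion for a given automorphism comes
  from its inverse.\<close>
lemma (in group) characteristic_generate_auto_images:
  assumes M: "M \<subseteq> carrier G"
  shows "characteristic_subgroup (generate G (\<Union>(auto_images G M))) G"
  unfolding characteristic_subgroup_def
proof (intro conjI ballI)
  let ?S = "\<Union>(auto_images G M)"
  have S: "?S \<subseteq> carrier G" using M auto_image_carrier unfolding auto_images_def by blast
  then show "subgroup (generate G ?S) G" by (rule generate_is_subgroup)
  interpret Aut: group "AutoGroup G" by (rule AutoGroup)
  have mult: "compose (carrier G) \<phi> \<psi> \<in> auto G" if "\<phi> \<in> auto G" "\<psi> \<in> auto G" for \<phi> \<psi>
    using Aut.m_closed[of \<phi> \<psi>] that by (simp add: AutoGroup_def BijGroup_def auto_def)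
  have into: "\<phi> ` ?S \<subseteq> ?S" if \<phi>: "\<phi> \<in> auto G" for \<phi>
  proof
    fix x assume "x \<in> \<phi> ` ?S"
    then obtain \<psi> m where "\<psi> \<in> auto G" "m \<in> M" "x = \<phi> (\<psi> m)"
      unfolding auto_images_def by blast
    moreover from this have "x = compose (carrier G) \<phi> \<psi> m" using M by (auto simp: compose_def)
    ultimately show "x \<in> ?S" using mult[OF \<phi>] unfolding auto_images_def by blast
  qed
  fix \<phi> assume \<phi>: "\<phi> \<in> auto G"
  interpret \<phi>: group_hom G G \<phi> by (rule auto_group_hom[OF \<phi>])
  define \<psi> where "\<psi> = restrict (inv_into (carrier G) \<phi>) (carrier G)"
  have \<psi>: "\<psi> \<in> auto G"
    using \<phi> by (simp add: \<psi>_def auto_def restrict_inv_into_hom restrict_inv_into_Bij)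
  have inv: "\<phi> (\<psi> x) = x" if "x \<in> carrier G" for x
    using that auto_image_carrier[OF \<phi>] by (simp add: \<psi>_def f_inv_into_f)
  have "?S \<subseteq> \<phi> ` ?S"
  proof
    fix x assume x: "x \<in> ?S"
    then have "\<psi> x \<in> ?S" using into[OF \<psi>] by blast
    moreover have "x = \<phi> (\<psi> x)" using inv[of x] x S by (metis subsetD)
    ultimately show "x \<in> \<phi> ` ?S" by blast
  qed
  then have "\<phi> ` ?S = ?S" using into[OF \<phi>] by blast
  then show "\<phi> ` generate G ?S = generate G ?S" using \<phi>.generate_img[OF S] by simp
qed

text \<open>This is where the group has to be a \<open>p\<close>-group. In the subgroup \<open>J\<close> generated by all images, \<open>r\<close>
  elements together with \<open>M\<close> generate. By the Burnside basis property these \<open>r\<close> elements can be taken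
  from the union of the images, and \<open>r\<close> images that contain them generate \<open>J\<close> together with \<open>M\<close>
  itself.\<close>
lemma (in group) generate_auto_images_by_few:
  assumes fin: "finite (carrier G)" and ord: "order G = p ^ k" and p: "Factorial_Ring.prime p"
    and M: "subgroup M G" and cr: "corank_le G M r"
  obtains \<E> where "\<E> \<subseteq> auto_images G M" "M \<in> \<E>" "finite \<E>" "card \<E> \<le> r + 1"
    "generate G (\<Union>\<E>) = generate G (\<Union>(auto_images G M))"
proof -
  let ?S = "\<Union>(auto_images G M)"
  define J where "J = generate G ?S"
  have Msub: "M \<subseteq> carrier G" by (rule subgroup.subset[OF M])
  have S: "?S \<subseteq> carrier G" using Msub auto_image_carrier unfolding auto_images_def by blast
  have J: "subgroup J G" unfolding J_def by (rule generate_is_subgroup[OF S])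
  have SJ: "?S \<subseteq> J" unfolding J_def using generate.incl[of _ ?S G] by blast
  then have MJ: "M \<subseteq> J" using self_in_auto_images[OF Msub] by blast
  obtain T where T: "finite T" "T \<subseteq> J" "card T \<le> r" "generate G (T \<union> (J \<inter> M)) = J"
    using corank_leE[OF cr J] .
  have JM: "J \<inter> M = M" using MJ by blast
  let ?J = "G\<lparr>carrier := J\<rparr>"
  interpret J: group ?J by (rule subgroup_imp_group[OF J])
  have gen: "generate ?J U = generate G U" if "U \<subseteq> J" for U
    using generate_consistent[OF that J] .
  have "order ?J dvd p ^ k"
    using lagrange[OF J] ord by (simp add: order_def) (metis dvd_triv_right)
  then obtain i where i: "order ?J = p ^ i" using divides_primepow_nat[OF p] by blast
  have finJ: "finite (carrier ?J)" using finite_subset[OF subgroup.subset[OF J] fin] by simp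
  have "?S \<union> M = ?S" using self_in_auto_images[OF Msub] by blast
  then have genS: "generate ?J (?S \<union> M) = carrier ?J" using gen[OF SJ] by (simp add: J_def)
  have genT: "generate ?J (T \<union> M) = carrier ?J" using gen[of "T \<union> M"] T(2,4) MJ JM by simp
  have sets: "M \<subseteq> carrier ?J" "T \<subseteq> carrier ?J" "?S \<subseteq> carrier ?J" using MJ T(2) SJ by simp_all
  obtain B where B: "B \<subseteq> ?S" "card B \<le> card T" "generate ?J (B \<union> M) = carrier ?J"
    using J.p_group_generators_from_set[OF finJ i p sets(1,2) genT sets(3) genS] .
  have "\<forall>x\<in>B. \<exists>E\<in>auto_images G M. x \<in> E" using B(1) by blast
  then obtain e where e: "\<And>x. x \<in> B \<Longrightarrow> e x \<in> auto_images G M" "\<And>x. x \<in> B \<Longrightarrow> x \<in> e x"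
    by metis
  define \<E> where "\<E> = insert M (e ` B)"
  have finX: "finite B" using finite_subset[OF B(1)] finite_subset[OF S fin] by blast
  have sub: "\<E> \<subseteq> auto_images G M" using e(1) self_in_auto_images[OF Msub] by (auto simp: \<E>_def)
  have "B \<union> M \<subseteq> \<Union>\<E>" using e(2) by (auto simp: \<E>_def)
  moreover have "generate G (B \<union> M) = J" using gen[of "B \<union> M"] B(1,3) SJ MJ by simp
  ultimately have "J \<subseteq> generate G (\<Union>\<E>)" using mono_generate[of "B \<union> M" "\<Union>\<E>"] by simp
  moreover have "generate G (\<Union>\<E>) \<subseteq> J" unfolding J_def using sub by (intro mono_generate) blast
  moreover have "card \<E> \<le> r + 1"
    using card_image_le[OF finX, of e] card_insert_le_m1[of "r + 1" "e ` B" M] B(2) T(3)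
    by (simp add: \<E>_def)
  ultimately show thesis using that[of \<E>] sub finX by (simp add: \<E>_def J_def)
qed

lemma (in group) Inter_normal:
  assumes "\<E> \<noteq> {}" "\<And>E. E \<in> \<E> \<Longrightarrow> E \<lhd> G"
  shows "\<Inter>\<E> \<lhd> G"
  unfolding normal_inv_iff
proof (intro conjI ballI InterI)
  show "subgroup (\<Inter>\<E>) G" using assms normal_imp_subgroup by (intro subgroups_Inter) auto
  fix g h E assume "g \<in> carrier G" "h \<in> \<Inter>\<E>" "E \<in> \<E>"
  then show "g \<otimes> h \<otimes> inv g \<in> E" using assms(2)[of E] by (auto simp: normal_inv_iff)
qed

section \<open>Values of words\<close>

lemma word_value_Nil [simp]: "word_value G \<sigma> [] = \<one>\<^bsub>G\<^esub>"
  by (simp add: word_value_def)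

lemma word_value_Cons [simp]: "word_value G \<sigma> ((i, b) # w) =
    (if b then \<sigma> i else inv\<^bsub>G\<^esub> (\<sigma> i)) \<otimes>\<^bsub>G\<^esub> word_value G \<sigma> w"
  by (simp add: word_value_def)

lemma word_value_cong:
  assumes "\<And>i. i \<in> word_letters w \<Longrightarrow> \<sigma> i = \<tau> i"
  shows "word_value G \<sigma> w = word_value G \<tau> w"
  using assms by (induction w) (auto simp: word_letters_def)

context group
begin

lemma word_value_closed [simp]:
  "\<sigma> \<in> UNIV \<rightarrow> carrier G \<Longrightarrow> word_value G \<sigma> w \<in> carrier G"
  by (induction w) (auto simp: Pi_iff)

lemma word_value_append:
  "\<sigma> \<in> UNIV \<rightarrow> carrier G \<Longrightarrow> word_value G \<sigma> (u @ v) = word_value G \<sigma> u \<otimes> word_value G \<sigma> v"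
  by (induction u) (auto simp: Pi_iff m_assoc)

lemma word_value_inv:
  assumes \<sigma>: "\<sigma> \<in> UNIV \<rightarrow> carrier G"
  shows "word_value G \<sigma> (word_inv w) = inv (word_value G \<sigma> w)"
proof (induction w)
  case (Cons a w)
  obtain i b where a: "a = (i, b)" by (cases a)
  have "word_inv (a # w) = word_inv w @ [(i, \<not> b)]" by (simp add: word_inv_def a)
  then show ?case using Cons \<sigma> by (auto simp: word_value_append[OF \<sigma>] a inv_mult_group Pi_iff)
qed (simp add: word_inv_def)

lemma word_value_comm:
  assumes \<sigma>: "\<sigma> \<in> UNIV \<rightarrow> carrier G"
  shows "word_value G \<sigma> (word_comm u v) =
    inv (word_value G \<sigma> u) \<otimes> inv (word_value G \<sigma> v) \<otimes> word_value G \<sigma> u \<otimes> word_value G \<sigma> v"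
  using \<sigma> by (simp add: word_comm_def word_value_append word_value_inv m_assoc)

end

lemma (in group_hom) word_value_hom:
  "\<sigma> \<in> UNIV \<rightarrow> carrier G \<Longrightarrow> word_value H (h \<circ> \<sigma>) w = h (word_value G \<sigma> w)"
  by (induction w) (auto simp: Pi_iff)

lemma (in group) satisfies_identity_subgroup_iff:
  assumes H: "subgroup H G"
  shows "satisfies_identity (G\<lparr>carrier := H\<rparr>) w \<longleftrightarrow> (\<forall>\<sigma> \<in> UNIV \<rightarrow> H. word_value G \<sigma> w = \<one>)"
proof -
  have "word_value (G\<lparr>carrier := H\<rparr>) \<sigma> w = word_value G \<sigma> w" if "\<sigma> \<in> UNIV \<rightarrow> H" for \<sigma>
    using that by (induction w) (auto simp: Pi_iff m_inv_consistent[OF H])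
  then show ?thesis by (simp add: satisfies_identity_def)
qed

lemma word_letters_word_comm: "word_letters (word_comm u v) = word_letters u \<union> word_letters v"
  by (force simp: word_letters_def word_comm_def word_inv_def image_iff)

lemma card_word_letters_outer_commutator:
  assumes "outer_commutator t w"
  shows "card (word_letters w) = t"
  using assms
proof induction
  case (comm r u s v)
  have "finite (word_letters u)" "finite (word_letters v)" by (simp_all add: word_letters_def)
  then show ?case using comm by (simp add: word_letters_word_comm card_Un_disjoint)
qed (simp add: word_letters_def)

section \<open>Outer commutators are linear in each letter\<close>

lemma (in normal) commutator_mem_iff:
  assumes x: "x \<in> carrier G" and y: "y \<in> carrier G"
  shows "inv x \<otimes> inv y \<otimes> x \<otimes> y \<in> H \<longleftrightarrow> H #> (x \<otimes> y) = H #> (y \<otimes> x)"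
proof -
  let ?c = "inv x \<otimes> inv y \<otimes> x \<otimes> y"
  have eq: "(y \<otimes> x) \<otimes> ?c = x \<otimes> y"
    using x y by (simp add: m_assoc) (simp add: m_assoc[symmetric])
  show ?thesis
  proof
    assume "?c \<in> H"
    then have "(y \<otimes> x) \<otimes> ?c \<in> (y \<otimes> x) <# H" by (auto simp: l_coset_def)
    then have "x \<otimes> y \<in> H #> (y \<otimes> x)" using x y coset_eq eq by simp
    then show "H #> (x \<otimes> y) = H #> (y \<otimes> x)"
      using repr_independence[OF _ _ subgroup_axioms] x y by simp
  next
    assume "H #> (x \<otimes> y) = H #> (y \<otimes> x)"
    then have "x \<otimes> y \<in> (y \<otimes> x) <# H"
      using repr_independenceD[OF subgroup_axioms, of "x \<otimes> y" "y \<otimes> x"] x y coset_eq by simp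
    then obtain h where "h \<in> H" "x \<otimes> y = (y \<otimes> x) \<otimes> h" by (auto simp: l_coset_def)
    then show "?c \<in> H" using eq x y by (metis inv_closed l_cancel m_closed mem_carrier)
  qed
qed

text \<open>Applied to the projection onto a quotient, this describes the elements that commute with \<open>V\<close> modulo a
  normal subgroup.\<close>
lemma (in group_hom) centralizer_of_image_normal:
  assumes V: "V \<subseteq> carrier G"
    and conj: "\<And>g v. g \<in> carrier G \<Longrightarrow> v \<in> V \<Longrightarrow> g \<otimes>\<^bsub>G\<^esub> v \<otimes>\<^bsub>G\<^esub> inv\<^bsub>G\<^esub> g \<in> V"
  shows "{x \<in> carrier G. \<forall>v\<in>V. h (x \<otimes>\<^bsub>G\<^esub> v) = h (v \<otimes>\<^bsub>G\<^esub> x)} \<lhd> G"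
    (is "?C \<lhd> G")
proof -
  have Vc: "v \<in> carrier G" if "v \<in> V" for v using that V by blast
  have "subgroup ?C G"
  proof (rule G.subgroupI)
    have "\<one>\<^bsub>G\<^esub> \<in> ?C" using Vc by simp
    then show "?C \<noteq> {}" by blast
  next
    fix x assume x: "x \<in> ?C"
    have "h (inv\<^bsub>G\<^esub> x \<otimes>\<^bsub>G\<^esub> v) = h (v \<otimes>\<^bsub>G\<^esub> inv\<^bsub>G\<^esub> x)" if v: "v \<in> V" for v
    proof -
      have c: "h x \<in> carrier H" "h v \<in> carrier H" and eq: "h x \<otimes>\<^bsub>H\<^esub> h v = h v \<otimes>\<^bsub>H\<^esub> h x"
        using x v Vc[OF v] by auto
      have "h v = inv\<^bsub>H\<^esub> h x \<otimes>\<^bsub>H\<^esub> (h v \<otimes>\<^bsub>H\<^esub> h x)"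
        using c unfolding eq[symmetric] by (simp add: H.m_assoc[symmetric])
      then have "h v \<otimes>\<^bsub>H\<^esub> inv\<^bsub>H\<^esub> h x = inv\<^bsub>H\<^esub> h x \<otimes>\<^bsub>H\<^esub> h v"
        using c by (metis H.inv_closed H.inv_solve_right H.m_assoc H.m_closed)
      then show ?thesis using x Vc[OF v] by simp
    qed
    then show "inv\<^bsub>G\<^esub> x \<in> ?C" using x by simp
  next
    fix x y assume x: "x \<in> ?C" and y: "y \<in> ?C"
    have "h (x \<otimes>\<^bsub>G\<^esub> y \<otimes>\<^bsub>G\<^esub> v) = h (v \<otimes>\<^bsub>G\<^esub> (x \<otimes>\<^bsub>G\<^esub> y))" if v: "v \<in> V" for v
    proof -
      have c: "h x \<in> carrier H" "h y \<in> carrier H" "h v \<in> carrier H"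
        and eq: "h x \<otimes>\<^bsub>H\<^esub> h v = h v \<otimes>\<^bsub>H\<^esub> h x" "h y \<otimes>\<^bsub>H\<^esub> h v = h v \<otimes>\<^bsub>H\<^esub> h y"
        using x y v Vc[OF v] by auto
      have "h x \<otimes>\<^bsub>H\<^esub> h y \<otimes>\<^bsub>H\<^esub> h v = h x \<otimes>\<^bsub>H\<^esub> h v \<otimes>\<^bsub>H\<^esub> h y"
        using c eq(2) by (simp add: H.m_assoc)
      also have "\<dots> = h v \<otimes>\<^bsub>H\<^esub> (h x \<otimes>\<^bsub>H\<^esub> h y)" using c eq(1) by (simp add: H.m_assoc)
      finally show ?thesis using x y Vc[OF v] by simp
    qed
    then show "x \<otimes>\<^bsub>G\<^esub> y \<in> ?C" using x y by simp
  qed auto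
  moreover have "g \<otimes>\<^bsub>G\<^esub> x \<otimes>\<^bsub>G\<^esub> inv\<^bsub>G\<^esub> g \<in> ?C" if g: "g \<in> carrier G" and x: "x \<in> ?C" for g x
  proof -
    have xc: "x \<in> carrier G" using x by simp
    have "h (g \<otimes>\<^bsub>G\<^esub> x \<otimes>\<^bsub>G\<^esub> inv\<^bsub>G\<^esub> g \<otimes>\<^bsub>G\<^esub> v) = h (v \<otimes>\<^bsub>G\<^esub> (g \<otimes>\<^bsub>G\<^esub> x \<otimes>\<^bsub>G\<^esub> inv\<^bsub>G\<^esub> g))" if v: "v \<in> V" for v
    proof -
      define u where "u = inv\<^bsub>G\<^esub> g \<otimes>\<^bsub>G\<^esub> v \<otimes>\<^bsub>G\<^esub> g"
      have u: "u \<in> V" using conj[of "inv\<^bsub>G\<^esub> g" v] g v by (simp add: u_def)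
      note c = g xc Vc[OF v] Vc[OF u]
      have v': "v = g \<otimes>\<^bsub>G\<^esub> u \<otimes>\<^bsub>G\<^esub> inv\<^bsub>G\<^esub> g"
        using g Vc[OF v] by (simp add: u_def G.m_assoc) (simp add: G.m_assoc[symmetric])
      have "g \<otimes>\<^bsub>G\<^esub> x \<otimes>\<^bsub>G\<^esub> inv\<^bsub>G\<^esub> g \<otimes>\<^bsub>G\<^esub> v = g \<otimes>\<^bsub>G\<^esub> (x \<otimes>\<^bsub>G\<^esub> u) \<otimes>\<^bsub>G\<^esub> inv\<^bsub>G\<^esub> g"
        and "v \<otimes>\<^bsub>G\<^esub> (g \<otimes>\<^bsub>G\<^esub> x \<otimes>\<^bsub>G\<^esub> inv\<^bsub>G\<^esub> g) = g \<otimes>\<^bsub>G\<^esub> (u \<otimes>\<^bsub>G\<^esub> x) \<otimes>\<^bsub>G\<^esub> inv\<^bsub>G\<^esub> g"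
        unfolding v' using c by (simp_all add: G.m_assoc) (simp_all add: G.m_assoc[symmetric])
      moreover have "h (x \<otimes>\<^bsub>G\<^esub> u) = h (u \<otimes>\<^bsub>G\<^esub> x)" using x u by blast
      ultimately show ?thesis using c by (simp del: hom_mult add: hom_mult[of "g \<otimes>\<^bsub>G\<^esub> _"] hom_mult[of g])
    qed
    then show ?thesis using g xc by simp
  qed
  ultimately show ?thesis by (simp add: G.normal_inv_iff)
qed

lemma (in group) word_values_conj_closed:
  assumes A: "\<And>i. A i \<subseteq> carrier G" "\<And>i g a. g \<in> carrier G \<Longrightarrow> a \<in> A i \<Longrightarrow> g \<otimes> a \<otimes> inv g \<in> A i"
    and g: "g \<in> carrier G" and x: "x \<in> (\<lambda>\<sigma>. word_value G \<sigma> w) ` Pi UNIV A"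
  shows "g \<otimes> x \<otimes> inv g \<in> (\<lambda>\<sigma>. word_value G \<sigma> w) ` Pi UNIV A"
proof -
  obtain \<sigma> where \<sigma>: "\<sigma> \<in> Pi UNIV A" "x = word_value G \<sigma> w" using x by blast
  have \<sigma>c: "\<sigma> \<in> UNIV \<rightarrow> carrier G" using \<sigma>(1) A(1) by blast
  let ?c = "\<lambda>x\<in>carrier G. g \<otimes> x \<otimes> inv g"
  interpret c: group_hom G G ?c by (rule auto_group_hom[OF inner_automorphism[OF g]])
  have "?c \<circ> \<sigma> \<in> Pi UNIV A" using \<sigma>(1) \<sigma>c A(2)[OF g] by (auto simp: Pi_iff)
  moreover have "word_value G (?c \<circ> \<sigma>) w = g \<otimes> x \<otimes> inv g"
    using c.word_value_hom[OF \<sigma>c] \<sigma>(2) word_value_closed[OF \<sigma>c] by simp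
  ultimately show ?thesis by (metis image_eqI)
qed

text \<open>For \<open>w = [u, v]\<close> with \<open>j\<close> in \<open>u\<close>, the condition on \<open>w\<close> says that the values of \<open>u\<close> lie in the set of
  elements commuting modulo \<open>R\<close> with all values of \<open>v\<close>. The values of \<open>v\<close> form a conjugation-invariant
  set, so these elements form a normal subgroup, and the claim for \<open>u\<close> with this subgroup in place of
  \<open>R\<close> gives the claim for \<open>w\<close>. This is why the statement has to be general in \<open>R\<close>, although only the
  trivial subgroup matters in the end. The case of \<open>j\<close> in \<open>v\<close> is symmetric.\<close>
lemma (in group) outer_commutator_values_generate:
  assumes oc: "outer_commutator t w" and j: "j \<in> word_letters w" and R: "R \<lhd> G"
    and S: "S \<subseteq> carrier G" and A: "\<And>i. i \<noteq> j \<Longrightarrow> A i \<lhd> G"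
    and vals: "\<And>\<sigma>. \<sigma> \<in> Pi UNIV (A(j := S)) \<Longrightarrow> word_value G \<sigma> w \<in> R"
    and \<sigma>: "\<sigma> \<in> Pi UNIV (A(j := generate G S))"
  shows "word_value G \<sigma> w \<in> R"
  using oc j R vals \<sigma>
proof (induction arbitrary: R \<sigma>)
  case (letter i)
  then have ij: "i = j" by (simp add: word_letters_def)
  have Rs: "subgroup R G" by (rule normal_imp_subgroup[OF letter(2)])
  have one: "\<one> \<in> A i" if "i \<noteq> j" for i
    using subgroup.one_closed[OF normal_imp_subgroup[OF A[OF that]]] .
  have "S \<subseteq> R"
  proof
    fix s assume s: "s \<in> S"
    have "(\<lambda>i. if i = j then s else \<one>) \<in> Pi UNIV (A(j := S))" using s one by auto
    from letter(3)[OF this] show "s \<in> R" using s S by (auto simp: ij)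
  qed
  then have "generate G S \<subseteq> R" by (rule generate_subgroup_incl[OF _ Rs])
  moreover have "\<sigma> j \<in> generate G S" using letter(4) by (auto simp: Pi_iff dest: spec[of _ j])
  ultimately show ?case using subgroup.mem_carrier[OF Rs] by (auto simp: ij)
next
  case (comm r u s v)
  interpret R: normal R G by (rule comm.prems(2))
  let ?B = "A(j := carrier G)"
  have Bnorm: "?B i \<lhd> G" for i using A normal_self by simp
  have Bsub: "?B i \<subseteq> carrier G" for i
    using subgroup.subset[OF normal_imp_subgroup[OF Bnorm]] .
  have Bconj: "g \<otimes> a \<otimes> inv g \<in> ?B i" if "g \<in> carrier G" "a \<in> ?B i" for g a i
    using Bnorm[of i] that unfolding normal_inv_iff by blast
  have gS: "generate G S \<subseteq> carrier G" by (rule generate_incl[OF S])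
  have inB: "\<tau> \<in> Pi UNIV ?B" if "\<tau> \<in> Pi UNIV (A(j := Q))" "Q \<subseteq> carrier G" for \<tau> Q
    using that by (auto simp: Pi_iff split: if_splits)
  have inG: "\<tau> \<in> UNIV \<rightarrow> carrier G" if "\<tau> \<in> Pi UNIV ?B" for \<tau>
    using that Bsub by blast
  \<comment> \<open>\<open>C w'\<close> consists of the elements that commute modulo \<open>R\<close> with all values of \<open>w'\<close>. It is used
    only for the factor \<open>w'\<close> without the letter \<open>j\<close>, so the range chosen for \<open>j\<close> does not matter.\<close>
  define C where "C w' = {x \<in> carrier G. \<forall>y \<in> (\<lambda>\<sigma>. word_value G \<sigma> w') ` Pi UNIV ?B.
      R #> (x \<otimes> y) = R #> (y \<otimes> x)}" for w'
  have C: "C w' \<lhd> G" for w'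
    unfolding C_def
  proof (rule group_hom.centralizer_of_image_normal[OF R.projection_group_hom])
    show "(\<lambda>\<sigma>. word_value G \<sigma> w') ` Pi UNIV ?B \<subseteq> carrier G"
      using inG by (intro image_subsetI word_value_closed) blast
  qed (use word_values_conj_closed[of ?B, OF Bsub Bconj] in blast)
  \<comment> \<open>As \<open>u\<close> and \<open>v\<close> have no common letter, their arguments can be chosen independently.\<close>
  have mix: "R #> (word_value G \<sigma> u \<otimes> word_value G \<tau> v) = R #> (word_value G \<tau> v \<otimes> word_value G \<sigma> u)"
    if "\<sigma> \<in> Pi UNIV ?B" "\<tau> \<in> Pi UNIV ?B"
      and j: "(if j \<in> word_letters u then \<sigma> j else \<tau> j) \<in> S" for \<sigma> \<tau>
  proof -
    define \<rho> where "\<rho> i = (if i \<in> word_letters u then \<sigma> i else \<tau> i)" for i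
    have \<rho>: "\<rho> \<in> Pi UNIV (A(j := S))"
      using that by (auto simp: \<rho>_def Pi_iff split: if_splits)
    have \<rho>c: "\<rho> \<in> UNIV \<rightarrow> carrier G" using inG[OF inB[OF \<rho> S]] .
    have "word_value G \<rho> u = word_value G \<sigma> u" by (rule word_value_cong) (simp add: \<rho>_def)
    moreover have "word_value G \<rho> v = word_value G \<tau> v"
      by (rule word_value_cong) (use comm.hyps in \<open>auto simp: \<rho>_def\<close>)
    moreover have "R #> (word_value G \<rho> u \<otimes> word_value G \<rho> v)
        = R #> (word_value G \<rho> v \<otimes> word_value G \<rho> u)"
      using comm.prems(3)[OF \<rho>] R.commutator_mem_iff \<rho>c by (simp add: word_value_comm)
    ultimately show ?thesis by simp
  qed
  have \<sigma>B: "\<sigma> \<in> Pi UNIV ?B" using inB[OF comm.prems(4) gS] .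
  have "R #> (word_value G \<sigma> u \<otimes> word_value G \<sigma> v) = R #> (word_value G \<sigma> v \<otimes> word_value G \<sigma> u)"
  proof (cases "j \<in> word_letters u")
    case True
    have "word_value G \<tau> u \<in> C v" if \<tau>: "\<tau> \<in> Pi UNIV (A(j := S))" for \<tau>
    proof -
      have \<tau>B: "\<tau> \<in> Pi UNIV ?B" and "\<tau> j \<in> S" using inB[OF \<tau> S] \<tau> by (auto simp: Pi_iff dest: spec[of _ j])
      then show ?thesis using mix True inG[OF \<tau>B] by (auto simp: C_def)
    qed
    then have "word_value G \<sigma> u \<in> C v" using comm.IH(1)[OF True C _ comm.prems(4)] by blast
    then show ?thesis using \<sigma>B by (auto simp: C_def)
  next
    case False
    then have jv: "j \<in> word_letters v" using comm.prems(1) by (simp add: word_letters_word_comm)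
    have "word_value G \<tau> v \<in> C u" if \<tau>: "\<tau> \<in> Pi UNIV (A(j := S))" for \<tau>
    proof -
      have \<tau>B: "\<tau> \<in> Pi UNIV ?B" and "\<tau> j \<in> S" using inB[OF \<tau> S] \<tau> by (auto simp: Pi_iff dest: spec[of _ j])
      then show ?thesis using mix False inG[OF \<tau>B] by (auto simp: C_def)
    qed
    then have "word_value G \<sigma> v \<in> C u" using comm.IH(2)[OF jv C _ comm.prems(4)] by blast
    then show ?thesis using \<sigma>B by (auto simp: C_def)
  qed
  then show ?case
    using R.commutator_mem_iff[of "word_value G \<sigma> u" "word_value G \<sigma> v"] inG[OF \<sigma>B]
    by (simp add: word_value_comm)
qed

section \<open>Moving the letters to characteristic subgroups\<close>

text \<open>One step of the construction, moving the letter \<open>j\<close>. Let \<open>J\<close> be generated by all automorphic images of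
  \<open>M\<close>, and \<open>K\<close> the intersection of at most \<open>r + 1\<close> images that already generate \<open>J\<close>. When \<open>j\<close> ranges
  over one of these images, applying an automorphism to the vanishing of \<open>w\<close> on \<open>H\<close> and \<open>M\<close> shows that
  \<open>w\<close> still vanishes with \<open>J \<subseteq> H\<close> at the letters in \<open>L\<close> and \<open>K\<close> at the others. By linearity \<open>j\<close> may
  range over all of \<open>J\<close>.\<close>
lemma (in group) exchange_letter:
  assumes fin: "finite (carrier G)" and ord: "order G = p ^ k" and p: "Factorial_Ring.prime p"
    and w: "outer_commutator t w" and j: "j \<in> word_letters w" "j \<notin> L"
    and H: "characteristic_subgroup H G" and M: "M \<lhd> G" "M \<subseteq> H" and cr: "corank_le G M r"
    and triv: "\<forall>\<sigma> \<in> Pi UNIV (\<lambda>i. if i \<in> L then H else M). word_value G \<sigma> w = \<one>"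
  obtains J K where "characteristic_subgroup J G" "M \<subseteq> J"
    "K \<lhd> G" "K \<subseteq> J" "corank_le G K (r * (r + 1))"
    "\<forall>\<sigma> \<in> Pi UNIV (\<lambda>i. if i \<in> insert j L then J else K). word_value G \<sigma> w = \<one>"
proof -
  let ?S = "\<Union>(auto_images G M)"
  define J where "J = generate G ?S"
  have Ms: "subgroup M G" by (rule normal_imp_subgroup[OF M(1)])
  have Msub: "M \<subseteq> carrier G" by (rule subgroup.subset[OF Ms])
  have Hs: "subgroup H G" and Hinv: "\<And>\<phi>. \<phi> \<in> auto G \<Longrightarrow> \<phi> ` H = H"
    using H by (simp_all add: characteristic_subgroup_def)
  have J: "characteristic_subgroup J G"
    unfolding J_def by (rule characteristic_generate_auto_images[OF Msub])
  have SH: "?S \<subseteq> H" unfolding auto_images_def using M(2) Hinv by blast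
  then have JH: "J \<subseteq> H" unfolding J_def by (rule generate_subgroup_incl[OF _ Hs])
  obtain \<E> where \<E>: "\<E> \<subseteq> auto_images G M" "M \<in> \<E>" "finite \<E>" "card \<E> \<le> r + 1"
      and genE: "generate G (\<Union>\<E>) = J"
    using generate_auto_images_by_few[OF fin ord p Ms cr] unfolding J_def .
  define K where "K = \<Inter>\<E>"
  have EE: "\<exists>\<phi>\<in>auto G. E = \<phi> ` M" if "E \<in> \<E>" for E
    using \<E>(1) that unfolding auto_images_def by blast
  have E_normal: "E \<lhd> G" if "E \<in> \<E>" for E
    using EE[OF that] auto_image_normal[OF _ M(1)] by blast
  have E_corank: "corank_le G E r" if "E \<in> \<E>" for E
    using EE[OF that] corank_le_auto_image[OF _ Msub cr] by blast
  have K: "K \<lhd> G" unfolding K_def using Inter_normal[of \<E>] \<E>(2) E_normal by blast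
  have KM: "K \<subseteq> M" unfolding K_def using \<E>(2) by blast
  have MJ: "M \<subseteq> J" unfolding genE[symmetric] using \<E>(2) generate.incl[of _ "\<Union>\<E>" G] by blast
  have "corank_le G K (card \<E> * r)"
    unfolding K_def using \<E>(2,3) E_normal E_corank normal_imp_subgroup
    by (intro corank_le_Inter) auto
  moreover have "card \<E> * r \<le> r * (r + 1)" using mult_le_mono1[OF \<E>(4), of r] by (simp add: mult.commute)
  ultimately have K_corank: "corank_le G K (r * (r + 1))" unfolding corank_le_def by (meson le_trans)
  let ?A = "\<lambda>i. if i \<in> L then J else K"
  have Esub: "\<Union>\<E> \<subseteq> carrier G"
    using E_normal normal_imp_subgroup subgroup.subset by blast
  have A_normal: "?A i \<lhd> G" for i using characteristic_imp_normal[OF J] K by simp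
  have vals: "word_value G \<sigma> w \<in> {\<one>}" if \<sigma>: "\<sigma> \<in> Pi UNIV (?A(j := \<Union>\<E>))" for \<sigma>
  proof -
    have "\<sigma> j \<in> \<Union>\<E>" using \<sigma> by (auto simp: Pi_iff dest: spec[of _ j])
    then obtain E where E: "E \<in> \<E>" "\<sigma> j \<in> E" by blast
    obtain \<phi> where \<phi>: "\<phi> \<in> auto G" "E = \<phi> ` M" using EE[OF E(1)] by blast
    interpret \<phi>: group_hom G G \<phi> by (rule auto_group_hom[OF \<phi>(1)])
    \<comment> \<open>The whole assignment is the image under \<open>\<phi>\<close> of an assignment into \<open>H\<close> and \<open>M\<close>.\<close>
    have "\<exists>b. b \<in> (if i \<in> L then H else M) \<and> \<phi> b = \<sigma> i" for i
    proof -
      have "\<sigma> i \<in> (?A(j := \<Union>\<E>)) i" using \<sigma> by blast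
      then have "\<sigma> i \<in> (if i \<in> L then \<phi> ` H else \<phi> ` M)"
        using E \<phi>(2) j(2) JH Hinv[OF \<phi>(1)] K_def by (auto split: if_splits)
      then show ?thesis by (auto split: if_splits)
    qed
    then obtain \<tau> where \<tau>: "\<And>i. \<tau> i \<in> (if i \<in> L then H else M)" "\<And>i. \<phi> (\<tau> i) = \<sigma> i"
      by metis
    have \<tau>c: "\<tau> \<in> UNIV \<rightarrow> carrier G"
    proof
      fix i show "\<tau> i \<in> carrier G"
        using \<tau>(1)[of i] Msub subgroup.subset[OF Hs] by (auto split: if_splits)
    qed
    have "\<sigma> = \<phi> \<circ> \<tau>" using \<tau>(2) by auto
    then have "word_value G \<sigma> w = \<phi> (word_value G \<tau> w)" using \<phi>.word_value_hom[OF \<tau>c] by simp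
    also have "word_value G \<tau> w = \<one>" using triv \<tau>(1) by blast
    finally show ?thesis by simp
  qed
  have one: "{\<one>} \<lhd> G" by (simp add: normal_inv_iff triv_subgroup)
  have "word_value G \<sigma> w = \<one>" if \<sigma>: "\<sigma> \<in> Pi UNIV (\<lambda>i. if i \<in> insert j L then J else K)" for \<sigma>
  proof -
    have "?A(j := generate G (\<Union>\<E>)) = (\<lambda>i. if i \<in> insert j L then J else K)"
      by (auto simp: genE fun_eq_iff)
    then have "\<sigma> \<in> Pi UNIV (?A(j := generate G (\<Union>\<E>)))" using \<sigma> by (simp only:)
    from outer_commutator_values_generate[OF w j(1) one Esub A_normal vals this]
    show ?thesis by simp
  qed
  moreover have "K \<subseteq> J" using KM MJ by blast
  ultimately show thesis by (intro that[OF J MJ K _ K_corank] ballI)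
qed

text \<open>The iteration starts with \<open>H = G\<close> and \<open>M = N\<close>; \<open>L\<close> collects the letters already moved.\<close>
lemma (in group) exchange_letters:
  assumes fin: "finite (carrier G)" and ord: "order G = p ^ k" and p: "Factorial_Ring.prime p"
    and w: "outer_commutator t w" and N: "N \<lhd> G" "corank_le G N r"
    and triv: "\<forall>\<sigma> \<in> UNIV \<rightarrow> N. word_value G \<sigma> w = \<one>" and m: "m \<le> t"
  shows "\<exists>L H M. L \<subseteq> word_letters w \<and> card L = m \<and>
    characteristic_subgroup H G \<and> M \<lhd> G \<and> M \<subseteq> H \<and>
    corank_le G M (((\<lambda>x. x * (x + 1)) ^^ m) r) \<and>
    (\<forall>\<sigma> \<in> Pi UNIV (\<lambda>i. if i \<in> L then H else M). word_value G \<sigma> w = \<one>)"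
  using m
proof (induction m)
  case 0
  have "characteristic_subgroup (carrier G) G"
    using subgroup_self auto_image_carrier by (auto simp: characteristic_subgroup_def)
  moreover have "N \<subseteq> carrier G" by (rule subgroup.subset[OF normal_imp_subgroup[OF N(1)]])
  moreover have "\<forall>\<sigma> \<in> Pi UNIV (\<lambda>i. if i \<in> {} then carrier G else N). word_value G \<sigma> w = \<one>"
    using triv by simp
  ultimately have "{} \<subseteq> word_letters w \<and> card ({} :: nat set) = 0 \<and>
      characteristic_subgroup (carrier G) G \<and> N \<lhd> G \<and> N \<subseteq> carrier G \<and>
      corank_le G N (((\<lambda>x. x * (x + 1)) ^^ 0) r) \<and>
      (\<forall>\<sigma> \<in> Pi UNIV (\<lambda>i. if i \<in> {} then carrier G else N). word_value G \<sigma> w = \<one>)"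
    using N by simp
  then show ?case by fast
next
  case (Suc m)
  let ?f = "\<lambda>x::nat. x * (x + 1)"
  from Suc.IH[OF Suc_leD[OF Suc.prems]]
  obtain L H M where L: "L \<subseteq> word_letters w" "card L = m"
    and H: "characteristic_subgroup H G" and M: "M \<lhd> G" "M \<subseteq> H"
    and cr: "corank_le G M ((?f ^^ m) r)"
    and tr: "\<forall>\<sigma> \<in> Pi UNIV (\<lambda>i. if i \<in> L then H else M). word_value G \<sigma> w = \<one>"
    by (elim exE conjE)
  have "card L < card (word_letters w)"
    using card_word_letters_outer_commutator[OF w] L(2) Suc.prems by simp
  then obtain j where j: "j \<in> word_letters w" "j \<notin> L"
    by (metis L(1) nat_less_le subsetI subset_antisym)
  obtain J K where J: "characteristic_subgroup J G" "M \<subseteq> J"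
    and K: "K \<lhd> G" "K \<subseteq> J" "corank_le G K ((?f ^^ m) r * ((?f ^^ m) r + 1))"
    and trJ: "\<forall>\<sigma> \<in> Pi UNIV (\<lambda>i. if i \<in> insert j L then J else K). word_value G \<sigma> w = \<one>"
    using exchange_letter[OF fin ord p w j H M cr tr] .
  have "finite L" using L(1) by (rule finite_subset) (simp add: word_letters_def)
  then have "card (insert j L) = Suc m" using j(2) L(2) by simp
  moreover have "insert j L \<subseteq> word_letters w" using j(1) L(1) by simp
  moreover have "corank_le G K ((?f ^^ Suc m) r)" using K(3) by simp
  ultimately have "insert j L \<subseteq> word_letters w \<and> card (insert j L) = Suc m \<and>
      characteristic_subgroup J G \<and> K \<lhd> G \<and> K \<subseteq> J \<and> corank_le G K ((?f ^^ Suc m) r) \<and>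
      (\<forall>\<sigma> \<in> Pi UNIV (\<lambda>i. if i \<in> insert j L then J else K). word_value G \<sigma> w = \<one>)"
    using J(1) K(1,2) trJ by (intro conjI)
  then show ?case by (intro exI)
qed

theorem theorem3:
  fixes G :: "('a, 'b) monoid_scheme" (structure)
    and N :: "'a set" and p t :: nat and w :: gword
  assumes "Factorial_Ring.prime p"
    and "group G"
    and "finite (carrier G)"
    and "\<exists>k. order G = p ^ k"
    and "N \<lhd> G"
    and "outer_commutator t w"
    and "satisfies_identity (G\<lparr>carrier := N\<rparr>) w"
  shows "\<exists>H. characteristic_subgroup H G \<and> satisfies_identity (G\<lparr>carrier := H\<rparr>) w \<and>
    group_rank (G Mod H) \<le> ((\<lambda>x. x * (x + 1)) ^^ (t - 1)) (group_rank (G Mod N))"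
proof -
  interpret group G by (rule assms(2))
  let ?f = "\<lambda>x::nat. x * (x + 1)" and ?r = "group_rank (G Mod N)"
  note p = assms(1) and fin = assms(3) and w = assms(6)
  obtain k where ord: "order G = p ^ k" using assms(4) by blast
  have Ns: "subgroup N G" by (rule normal_imp_subgroup[OF assms(5)])
  have N_triv: "\<forall>\<sigma> \<in> UNIV \<rightarrow> N. word_value G \<sigma> w = \<one>"
    using assms(7) by (simp add: satisfies_identity_subgroup_iff[OF Ns])
  have N_corank: "corank_le G N ?r"
    by (rule normal.corank_le_group_rank_quotient[OF assms(5) fin])
  have t: "card (word_letters w) = t" by (rule card_word_letters_outer_commutator[OF w])
  have "0 < t" using w by (induction rule: outer_commutator.induct) auto
  \<comment> \<open>The last letter is moved separately: that step gives \<open>J\<close>, which contains \<open>M\<close> and so inherits its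
    bound, whereas the smaller subgroup \<open>K\<close> of that step has a weaker one.\<close>
  obtain L H M where L: "L \<subseteq> word_letters w" "card L = t - 1"
    and H: "characteristic_subgroup H G" and M: "M \<lhd> G" "M \<subseteq> H"
    and cr: "corank_le G M ((?f ^^ (t - 1)) ?r)"
    and tr: "\<forall>\<sigma> \<in> Pi UNIV (\<lambda>i. if i \<in> L then H else M). word_value G \<sigma> w = \<one>"
    using exchange_letters[OF fin ord p w assms(5) N_corank N_triv diff_le_self[of t 1]]
    by (elim exE conjE)
  have fw: "finite (word_letters w)" by (simp add: word_letters_def)
  have finL: "finite L" using L(1) fw by (rule finite_subset)
  have "card L < card (word_letters w)" using t L(2) \<open>0 < t\<close> by simp
  then obtain j where j: "j \<in> word_letters w" "j \<notin> L"
    by (metis L(1) nat_less_le subsetI subset_antisym)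
  have Lj: "insert j L = word_letters w"
    using L j t \<open>0 < t\<close> finL fw by (intro card_subset_eq) auto
  obtain J K where J: "characteristic_subgroup J G" "M \<subseteq> J" 
      and K: "K \<lhd> G" "K \<subseteq> J"
        "corank_le G K ((?f ^^ (t - 1)) ?r * ((?f ^^ (t - 1)) ?r + 1))"
      and trJ: "\<forall>\<sigma> \<in> Pi UNIV (\<lambda>i. if i \<in> insert j L then J else K). word_value G \<sigma> w = \<one>"
    using exchange_letter[OF fin ord p w j H M cr tr] .
  have Js: "subgroup J G" using J(1) by (simp add: characteristic_subgroup_def)
  \<comment> \<open>All letters of \<open>w\<close> now range over \<open>J\<close>; the values at other indices are reset to \<open>\<one>\<close>, which lies
    in \<open>K\<close>.\<close>
  have "word_value G \<sigma> w = \<one>" if \<sigma>: "\<sigma> \<in> UNIV \<rightarrow> J" for \<sigma>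
  proof -
    let ?\<tau> = "\<lambda>i. if i \<in> word_letters w then \<sigma> i else \<one>"
    have "\<one> \<in> K" using subgroup.one_closed[OF normal_imp_subgroup[OF K(1)]] .
    then have "word_value G ?\<tau> w = \<one>" using \<sigma> by (intro bspec[OF trJ]) (auto simp: Lj)
    moreover have "word_value G \<sigma> w = word_value G ?\<tau> w" by (rule word_value_cong) simp
    ultimately show ?thesis by simp
  qed
  then have "satisfies_identity (G\<lparr>carrier := J\<rparr>) w"
    by (simp add: satisfies_identity_subgroup_iff[OF Js])
  moreover have "group_rank (G Mod J) \<le> (?f ^^ (t - 1)) ?r"
  proof (rule normal.group_rank_quotient_le[OF characteristic_imp_normal[OF J(1)]])
    show "corank_le G J ((?f ^^ (t - 1)) ?r)" by (rule corank_le_mono[OF cr J(2)])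
    have "1 \<le> ?r" using fin by (intro group_rank_spec(1)) (simp add: carrier_FactGroup)
    then have "1 \<le> (?f ^^ m) ?r" for m by (induction m) (auto simp: Suc_le_eq)
    then show "1 \<le> (?f ^^ (t - 1)) ?r" .
  qed
  ultimately show ?thesis using J(1) by blast
qed

end
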